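(* Consider the min-max problem (M-DHRAS) $$\min_{x\in\mathcal X,\ a\in\mathcal A}\ \sup_{\mathbb P\in\mathcal F(\mathcal S,\mu)}\mathbb E_{\mathbb P}[f(x,a,\xi)],\qquad \mathcal F(\mathcal S,\mu)=\{\mathbb P \text{ probability distribution on }\mathcal S:\ \mathbb E_{\mathbb P}(\xi)=\mu\}.$$ This problem is equivalent to the following mixed-integer linear program, in the sense that the optimal values coincide and $(x,a)$ is optimal for M-DHRAS if and only if it can be completed to an optimal solution of the program: $$\min\ \sum_{i=1}^N\mu^{d}_i\rho_i+\sum_{j=2}^N\sum_{i=1}^N\sum_{i'\in[N]\setminus\{i\}}\mu^t_{i,i'}\eta_{i,i',j-1,j}+\lambda\sum_{i=1}^N\mu^t_{i,0}x_{i,N}+\sum_{i=1}^N\mu^t_{0,i}\psi_{0,i}+\sum_{j=1}^{N+2}\beta_j$$ over $x\in\mathcal X$, $a\in\mathcal A$, real variables $\alpha_{0,i},\alpha_{i,i'},\rho_i,\beta_j,\gamma,\delta$ and the linearization variables $\tau,\eta,\psi,\phi,\sigma,\xi_{i,j,v},\zeta$, subject to: (1) $\beta_1\ge -a_1\pi_{1,1}+\sum_{i=1}^N[\underline t_{0,i}(\pi_{1,1}x_{i,1}+\lambda x_{i,1}-\psi_{0,i})+\Delta t_{0,i}\sigma_{0,i,1,1}]$; (2) for all $v\in[2,N+2]_{\mathbb Z}$, with $m=\min(v,N+1)$: $\sum_{j=1}^v\beta_j\ge -a_1\pi_{1,v}+\sum_{j=2}^{m}(a_{j-1}-a_j)\pi_{j,v}+\sum_{i=1}^N[\underline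 t_{0,i}(\pi_{1,v}x_{i,1}+\lambda x_{i,1}-\psi_{0,i})+\Delta t_{0,i}\sigma_{0,i,1,v}]+\sum_{j=2}^{m}\sum_{i=1}^N\sum_{i'\ne i}[\underline t_{i,i'}(\pi_{j,v}\tau_{i,i',j-1,j}+\lambda\tau_{i,i',j-1,j}-\eta_{i,i',j-1,j})+\Delta t_{i,i'}\phi_{i,i',j,v}]+\sum_{j=2}^{m}\sum_{i=1}^N[\underline d_i(\pi_{j,v}x_{i,j-1}-\zeta_{i,j})+\Delta d_i\,\xi_{i,j,v}]$; (3) for all $k\in[2,N+1]_{\mathbb Z}$, $v\in[k,N+2]_{\mathbb Z}$, with $m=\min(v,N+1)$: $\sum_{j=k}^v\beta_j\ge\sum_{j=k}^{m}(a_{j-1}-a_j)\pi_{j,v}+\sum_{j=k}^{m}\sum_{i=1}^N[\underline d_i(\pi_{j,v}x_{i,j-1}-\zeta_{i,j})+\Delta d_i\,\xi_{i,j,v}]+\sum_{j=k}^{m}\sum_{i=1}^N\sum_{i'\neq i}[\underline t_{i,i'}(\pi_{j,v}\tau_{i,i',j-1,j}+\lambda\tau_{i,i',j-1,j}-\eta_{i,i',j-1,j})+\Delta t_{i,i'}\phi_{i,i',j,v}]$; (4) $\beta_{N+2}\ge0$; (5) $\gamma_{0,i,1,v}\ge0$ and $\gamma_{0,i,1,v}\ge\pi_{1,v}+\lambda-\alpha_{0,i}$ for $i\in[N]$, $v\in[N+2]$; $\gamma_{i,i',j,v}\ge0$ and $\gamma_{i,i',j,v}\ge\pi_{j,v}+\lambda-\alpha_{i,i'}$,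 and $\delta_{i,j,v}\ge0$ and $\delta_{i,j,v}\ge\pi_{j,v}-\rho_i$, for $i\in[N]$, $i'\in[N]\setminus\{i\}$, $j\in[2,N+1]_{\mathbb Z}$, $v\in[j,N+2]_{\mathbb Z}$; (6) the McCormick inequalities listed in the context.
   Context: Notation: $[m]=\{1,\dots,m\}$, $[k,m]_{\mathbb Z}=\{k,k+1,\dots,m\}$. $N$ is a positive integer (number of customers; index $0$ is the depot), $L>0$, and $c^w_j,c^u_j$ ($j\in[N]$), $c^o$, $\lambda$ are nonnegative reals. $\mathcal X$ is the set of $x\in\{0,1\}^{N\times N}$ with $\sum_{i}x_{i,j}=1$ for all $j\in[N]$ and $\sum_jx_{i,j}=1$ for all $i\in[N]$. $\mathcal A$ is the set of $a\in\mathbb R^N$ with $0\le a_j\le L$ for all $j\in[N]$ and $a_j\ge a_{j-1}$ for $j\in[2,N]_{\mathbb Z}$. Conventions: $a_{N+1}=L$ and $x_{i,N+1}=0$ for all $i$. $\xi=(t,d)$ with $d=(d_i)_{i\in[N]}$ and $t=(t_{i,i'})_{i,i'\in\{0,\dots,N\},\,i\ne i'}$. $\mathcal S$ is the box of all $\xi\ge 0$ with $\underline d_i\le d_i\le\overline d_i$ and $\underline t_{i,i'}\le t_{i,i'}\le\overline t_{i,i'}$; $\Delta d_i=\overline d_i-\underline d_i$, $\Delta t_{i,i'}=\overline t_{i,i'}-\underline t_{i,i'}$. $\mu=(\mu^t,\mu^d)$ is the mean of some probability distribution supported on $\mathcal S$. $f(x,a,\xi)$ is the optimal value of the linear program: minimize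 $\sum_{j=1}^N(c^w_jw_j+c^u_ju_j)+c^ow_{N+1}+\lambda A$ over $w,u\in\mathbb R_{\ge0}^{N+1}$ subject to $w_1-u_1=\sum_{i=1}^Nt_{0,i}x_{i,1}-a_1$; $w_j-w_{j-1}-u_j=a_{j-1}-a_j+\sum_{i=1}^Nd_ix_{i,j-1}+\sum_{i=1}^N\sum_{i'\in[N]\setminus\{i\}}t_{i,i'}x_{i,j-1}x_{i',j}$ for $j\in[2,N]_{\mathbb Z}$; $w_{N+1}-w_N-u_{N+1}=a_N-a_{N+1}+\sum_{i=1}^Nd_ix_{i,N}$; where $A=\sum_{j=2}^N\sum_{i=1}^N\sum_{i'\in[N]\setminus\{i\}}t_{i,i'}x_{i,j-1}x_{i',j}+\sum_{i=1}^N(t_{0,i}x_{i,1}+t_{i,0}x_{i,N})$. Set $c^w_{N+1}=c^o$, $c^u_{N+1}=c^w_{N+2}=c^u_{N+2}=0$, and $\pi_{j,v}=-c^u_v+\sum_{l=j}^{v-1}c^w_l$ for $1\le j\le v\le N+2$. Bounds: $P_1^u$ and $P_1^l$ are the maximum and minimum of $\pi_{j,v}$ over $j\in[2,N+1]_{\mathbb Z}$, $v\in[j,N+2]_{\mathbb Z}$; $P_2^u$ and $P_2^l$ are the maximum and minimum of $\pi_{1,v}$ over $v\in[N+2]$. $\underline\rho_i=P_1^l$, $\overline\rho_i=P_1^u$, $\underline\alpha_{i,i'}=P_1^l-\lambda$, $\overline\alpha_{i,i'}=P_1^u+\lambda$, $\underline\alpha_{0,i}=P_2^l-\lambda$, $\overline\alpha_{0,i}=P_2^u+\lambda$,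 $\overline\delta_{i,j,v}=\pi_{j,v}-P_1^l$, $\overline\gamma_{i,i',j,v}=\pi_{j,v}+2\lambda-P_1^l$, $\overline\gamma_{0,i,1,v}=\pi_{1,v}+2\lambda-P_2^l$. McCormick inequalities (for $i\in[N]$, $i'\in[N]\setminus\{i\}$, $j\in[2,N+1]_{\mathbb Z}$, $v\in[j,N+2]_{\mathbb Z}$, and $v\in[N+2]$ for $\sigma$): $\tau_{i,i',j-1,j}\ge x_{i,j-1}+x_{i',j}-1$, $\tau_{i,i',j-1,j}\ge0$, $\tau_{i,i',j-1,j}\le x_{i,j-1}$, $\tau_{i,i',j-1,j}\le x_{i',j}$; $\underline\alpha_{i,i'}\tau_{i,i',j-1,j}\le\eta_{i,i',j-1,j}\le\overline\alpha_{i,i'}\tau_{i,i',j-1,j}$, $\alpha_{i,i'}+\overline\alpha_{i,i'}(\tau_{i,i',j-1,j}-1)\le\eta_{i,i',j-1,j}\le\alpha_{i,i'}+\underline\alpha_{i,i'}(\tau_{i,i',j-1,j}-1)$; $\underline\alpha_{0,i}x_{i,1}\le\psi_{0,i}\le\overline\alpha_{0,i}x_{i,1}$, $\alpha_{0,i}+\overline\alpha_{0,i}(x_{i,1}-1)\le\psi_{0,i}\le\alpha_{0,i}+\underline\alpha_{0,i}(x_{i,1}-1)$; $\phi_{i,i',j,v}\ge\gamma_{i,i',j,v}+\overline\gamma_{i,i',j,v}(\tau_{i,i',j-1,j}-1)$, $\phi_{i,i',j,v}\ge0$, $\phi_{i,i',j,v}\le\overline\gamma_{i,i',j,v}\tau_{i,i',j-1,j}$,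 $\phi_{i,i',j,v}\le\gamma_{i,i',j,v}$; $\sigma_{0,i,1,v}\ge\gamma_{0,i,1,v}+\overline\gamma_{0,i,1,v}(x_{i,1}-1)$, $\sigma_{0,i,1,v}\ge0$, $\sigma_{0,i,1,v}\le\overline\gamma_{0,i,1,v}x_{i,1}$, $\sigma_{0,i,1,v}\le\gamma_{0,i,1,v}$; $\xi_{i,j,v}\ge\delta_{i,j,v}+\overline\delta_{i,j,v}(x_{i,j-1}-1)$, $\xi_{i,j,v}\ge0$, $\xi_{i,j,v}\le\delta_{i,j,v}$, $\xi_{i,j,v}\le\overline\delta_{i,j,v}x_{i,j-1}$ (here $\xi_{i,j,v}$ are scalar decision variables, unrelated to the random vector $\xi$); $\underline\rho_ix_{i,j-1}\le\zeta_{i,j}\le\overline\rho_ix_{i,j-1}$, $\rho_i+\overline\rho_i(x_{i,j-1}-1)\le\zeta_{i,j}\le\rho_i+\underline\rho_i(x_{i,j-1}-1)$.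
   Formalization: The formal theorem adds the assumption c^u_{j+1} ≤ c^u_j + c^w_j for 1 ≤ j < N, without which the equivalence fails, and takes the lower bounds on d and t to be nonnegative. *)

theory Defs
  imports "HOL-Probability.Probability"
begin

record dhras =
  customers :: nat                        (* N *)
  horizon :: real                         (* L *)
  wait_cost :: "nat \<Rightarrow> real"              (* c^w, indices 1..N *)
  idle_cost :: "nat \<Rightarrow> real"              (* c^u, indices 1..N *)
  over_cost :: real                       (* c^o *)
  travel_cost :: real                     (* lambda *)
  d_lo :: "nat \<Rightarrow> real"
  d_hi :: "nat \<Rightarrow> real"
  t_lo :: "nat \<Rightarrow> nat \<Rightarrow> real"
  t_hi :: "nat \<Rightarrow> nat \<Rightarrow> real"
  mu_d :: "nat \<Rightarrow> real"
  mu_t :: "nat \<Rightarrow> nat \<Rightarrow> real"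

(* First-stage decisions.  Matrices and vectors are total functions with pinned values outside
   their index range, so that x corresponds exactly to an element of {0,1}^(N x N), and the
   conventions x_{i,N+1} = 0 and a_{N+1} = L hold by construction. *)

definition assignments :: "dhras \<Rightarrow> (nat \<Rightarrow> nat \<Rightarrow> real) set" where
  "assignments p = {x.
     (\<forall>i\<in>{1..customers p}. \<forall>j\<in>{1..customers p}. x i j \<in> {0, 1}) \<and>
     (\<forall>i j. i \<notin> {1..customers p} \<or> j \<notin> {1..customers p} \<longrightarrow> x i j = 0) \<and>
     (\<forall>j\<in>{1..customers p}. (\<Sum>i=1..customers p. x i j) = 1) \<and>
     (\<forall>i\<in>{1..customers p}. (\<Sum>j=1..customers p. x i j) = 1)}"

definition schedules :: "dhras \<Rightarrow> (nat \<Rightarrow> real) set" where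
  "schedules p = {a.
     (\<forall>j\<in>{1..customers p}. 0 \<le> a j \<and> a j \<le> horizon p) \<and>
     (\<forall>j\<in>{2..customers p}. a (j - 1) \<le> a j) \<and>
     a (customers p + 1) = horizon p \<and>
     (\<forall>j. j \<notin> {1..customers p + 1} \<longrightarrow> a j = 0)}"

(* Scenarios xi = (t, d), with t indexed by pairs (i, i'). *)

type_synonym scenario = "(nat \<times> nat \<Rightarrow> real) \<times> (nat \<Rightarrow> real)"

definition arcs :: "dhras \<Rightarrow> (nat \<times> nat) set" where
  "arcs p = {(i, i'). i \<le> customers p \<and> i' \<le> customers p \<and> i \<noteq> i'}"

definition scenario_space :: "dhras \<Rightarrow> scenario measure" where
  "scenario_space p = (\<Pi>\<^sub>M e\<in>arcs p. borel) \<Otimes>\<^sub>M (\<Pi>\<^sub>M i\<in>{1..customers p}. borel)"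

definition support_set :: "dhras \<Rightarrow> scenario set" where
  "support_set p = {(t, d) \<in> space (scenario_space p).
     (\<forall>(i, i')\<in>arcs p. 0 \<le> t (i, i') \<and> t_lo p i i' \<le> t (i, i') \<and> t (i, i') \<le> t_hi p i i') \<and>
     (\<forall>i\<in>{1..customers p}. 0 \<le> d i \<and> d_lo p i \<le> d i \<and> d i \<le> d_hi p i)}"

definition ambiguity_set :: "dhras \<Rightarrow> scenario measure set" where
  "ambiguity_set p = {P. prob_space P \<and>
     sets P = sets (restrict_space (scenario_space p) (support_set p)) \<and>
     (\<forall>(i, i')\<in>arcs p. has_bochner_integral P (\<lambda>(t, d). t (i, i')) (mu_t p i i')) \<and>
     (\<forall>i\<in>{1..customers p}. has_bochner_integral P (\<lambda>(t, d). d i) (mu_d p i))}"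

(* Second-stage linear program. *)

definition travel_time :: "dhras \<Rightarrow> (nat \<Rightarrow> nat \<Rightarrow> real) \<Rightarrow> scenario \<Rightarrow> real" where
  "travel_time p x = (\<lambda>(t, d).
     (\<Sum>j=2..customers p. \<Sum>i=1..customers p. \<Sum>i'\<in>{1..customers p} - {i}.
        t (i, i') * x i (j - 1) * x i' j) +
     (\<Sum>i=1..customers p. t (0, i) * x i 1 + t (i, 0) * x i (customers p)))"

definition recourse_feasible ::
  "dhras \<Rightarrow> (nat \<Rightarrow> nat \<Rightarrow> real) \<Rightarrow> (nat \<Rightarrow> real) \<Rightarrow> scenario \<Rightarrow> ((nat \<Rightarrow> real) \<times> (nat \<Rightarrow> real)) set" where
  "recourse_feasible p x a = (\<lambda>(t, d). let N = customers p in {(w, u).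
     (\<forall>j\<in>{1..N + 1}. 0 \<le> w j \<and> 0 \<le> u j) \<and>
     w 1 - u 1 = (\<Sum>i=1..N. t (0, i) * x i 1) - a 1 \<and>
     (\<forall>j\<in>{2..N}. w j - w (j - 1) - u j =
        a (j - 1) - a j + (\<Sum>i=1..N. d i * x i (j - 1)) +
        (\<Sum>i=1..N. \<Sum>i'\<in>{1..N} - {i}. t (i, i') * x i (j - 1) * x i' j)) \<and>
     w (N + 1) - w N - u (N + 1) = a N - a (N + 1) + (\<Sum>i=1..N. d i * x i N)})"

(* For nonnegative costs this real infimum is over a nonempty set that is bounded below. *)
definition recourse ::
  "dhras \<Rightarrow> (nat \<Rightarrow> nat \<Rightarrow> real) \<Rightarrow> (nat \<Rightarrow> real) \<Rightarrow> scenario \<Rightarrow> real" where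
  "recourse p x a \<xi> = (INF (w, u) \<in> recourse_feasible p x a \<xi>.
     (\<Sum>j=1..customers p. wait_cost p j * w j + idle_cost p j * u j) +
     over_cost p * w (customers p + 1) + travel_cost p * travel_time p x \<xi>)"

definition worst_case :: "dhras \<Rightarrow> (nat \<Rightarrow> nat \<Rightarrow> real) \<Rightarrow> (nat \<Rightarrow> real) \<Rightarrow> ereal" where
  "worst_case p x a = (SUP P \<in> ambiguity_set p. ereal (\<integral>\<xi>. recourse p x a \<xi> \<partial>P))"

(* Cost coefficients extended to the indices N+1 and N+2. *)

definition cw :: "dhras \<Rightarrow> nat \<Rightarrow> real" where
  "cw p j = (if j \<le> customers p then wait_cost p j
             else if j = customers p + 1 then over_cost p else 0)"

definition cu :: "dhras \<Rightarrow> nat \<Rightarrow> real" where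
  "cu p j = (if j \<le> customers p then idle_cost p j else 0)"

(* The vectors with y_j = ppi p j v for j in a block {k..v} of a partition of {1..N+2} are feasible
   for the dual of the recourse program only if cu (j + 1) <= cu j + cw j for 1 <= j < N.
   Otherwise "recourse" may profit from delaying a customer on purpose (w_j and u_j both positive),
   and the epigraph constraints below overestimate it. *)
definition ppi :: "dhras \<Rightarrow> nat \<Rightarrow> nat \<Rightarrow> real" where
  "ppi p j v = - cu p v + (\<Sum>l\<in>{j..<v}. cw p l)"

definition P1u :: "dhras \<Rightarrow> real" where
  "P1u p = Max {ppi p j v | j v. j \<in> {2..customers p + 1} \<and> v \<in> {j..customers p + 2}}"

definition P1l :: "dhras \<Rightarrow> real" where
  "P1l p = Min {ppi p j v | j v. j \<in> {2..customers p + 1} \<and> v \<in> {j..customers p + 2}}"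

definition P2u :: "dhras \<Rightarrow> real" where
  "P2u p = Max {ppi p 1 v | v. v \<in> {1..customers p + 2}}"

definition P2l :: "dhras \<Rightarrow> real" where
  "P2l p = Min {ppi p 1 v | v. v \<in> {1..customers p + 2}}"

definition rho_lo :: "dhras \<Rightarrow> nat \<Rightarrow> real" where
  "rho_lo p i = P1l p"

definition rho_hi :: "dhras \<Rightarrow> nat \<Rightarrow> real" where
  "rho_hi p i = P1u p"

definition alpha_lo :: "dhras \<Rightarrow> nat \<Rightarrow> nat \<Rightarrow> real" where
  "alpha_lo p i i' = (if i = 0 then P2l p - travel_cost p else P1l p - travel_cost p)"

definition alpha_hi :: "dhras \<Rightarrow> nat \<Rightarrow> nat \<Rightarrow> real" where
  "alpha_hi p i i' = (if i = 0 then P2u p + travel_cost p else P1u p + travel_cost p)"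

definition delta_hi :: "dhras \<Rightarrow> nat \<Rightarrow> nat \<Rightarrow> nat \<Rightarrow> real" where
  "delta_hi p i j v = ppi p j v - P1l p"

definition gamma_hi :: "dhras \<Rightarrow> nat \<Rightarrow> nat \<Rightarrow> nat \<Rightarrow> nat \<Rightarrow> real" where
  "gamma_hi p i i' j v =
     (if i = 0 then ppi p j v + 2 * travel_cost p - P2l p
      else ppi p j v + 2 * travel_cost p - P1l p)"

(* The remaining variables of the mixed-integer program.  Redundant indices are dropped:
   tau i i' j, eta i i' j, psi i, sigma i v stand for tau_{i,i',j-1,j}, eta_{i,i',j-1,j},
   psi_{0,i}, sigma_{0,i,1,v}; index 0 in alpha and gamma is the depot. *)

record milp_vars =
  alpha :: "nat \<Rightarrow> nat \<Rightarrow> real"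
  rho :: "nat \<Rightarrow> real"
  beta :: "nat \<Rightarrow> real"
  gamma :: "nat \<Rightarrow> nat \<Rightarrow> nat \<Rightarrow> nat \<Rightarrow> real"
  delta :: "nat \<Rightarrow> nat \<Rightarrow> nat \<Rightarrow> real"
  tau :: "nat \<Rightarrow> nat \<Rightarrow> nat \<Rightarrow> real"
  eta :: "nat \<Rightarrow> nat \<Rightarrow> nat \<Rightarrow> real"
  psi :: "nat \<Rightarrow> real"
  phi :: "nat \<Rightarrow> nat \<Rightarrow> nat \<Rightarrow> nat \<Rightarrow> real"
  sigma :: "nat \<Rightarrow> nat \<Rightarrow> real"
  xi :: "nat \<Rightarrow> nat \<Rightarrow> nat \<Rightarrow> real"
  zeta :: "nat \<Rightarrow> nat \<Rightarrow> real"

definition milp_objective :: "dhras \<Rightarrow> (nat \<Rightarrow> nat \<Rightarrow> real) \<Rightarrow> milp_vars \<Rightarrow> real" where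
  "milp_objective p x z = (let N = customers p in
     (\<Sum>i=1..N. mu_d p i * rho z i) +
     (\<Sum>j=2..N. \<Sum>i=1..N. \<Sum>i'\<in>{1..N} - {i}. mu_t p i i' * eta z i i' j) +
     travel_cost p * (\<Sum>i=1..N. mu_t p i 0 * x i N) +
     (\<Sum>i=1..N. mu_t p 0 i * psi z i) +
     (\<Sum>j=1..N + 2. beta z j))"

(* The blocks of the right-hand sides of the epigraph constraints for the travel times from the
   depot, the travel times between customers, and the service times. *)

definition depot_block :: "dhras \<Rightarrow> (nat \<Rightarrow> nat \<Rightarrow> real) \<Rightarrow> milp_vars \<Rightarrow> nat \<Rightarrow> real" where
  "depot_block p x z v = (\<Sum>i=1..customers p.
     t_lo p 0 i * (ppi p 1 v * x i 1 + travel_cost p * x i 1 - psi z i) +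
     (t_hi p 0 i - t_lo p 0 i) * sigma z i v)"

definition travel_block :: "dhras \<Rightarrow> milp_vars \<Rightarrow> nat \<Rightarrow> nat \<Rightarrow> real" where
  "travel_block p z j v = (\<Sum>i=1..customers p. \<Sum>i'\<in>{1..customers p} - {i}.
     t_lo p i i' * (ppi p j v * tau z i i' j + travel_cost p * tau z i i' j - eta z i i' j) +
     (t_hi p i i' - t_lo p i i') * phi z i i' j v)"

definition service_block :: "dhras \<Rightarrow> (nat \<Rightarrow> nat \<Rightarrow> real) \<Rightarrow> milp_vars \<Rightarrow> nat \<Rightarrow> nat \<Rightarrow> real" where
  "service_block p x z j v = (\<Sum>i=1..customers p.
     d_lo p i * (ppi p j v * x i (j - 1) - zeta z i j) +
     (d_hi p i - d_lo p i) * xi z i j v)"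

definition epigraph_constraints ::
  "dhras \<Rightarrow> (nat \<Rightarrow> nat \<Rightarrow> real) \<Rightarrow> (nat \<Rightarrow> real) \<Rightarrow> milp_vars \<Rightarrow> bool" where
  "epigraph_constraints p x a z \<longleftrightarrow> (let N = customers p in
     beta z 1 \<ge> - a 1 * ppi p 1 1 + depot_block p x z 1 \<and>
     (\<forall>v\<in>{2..N + 2}. let m = min v (N + 1) in
        (\<Sum>j=1..v. beta z j) \<ge>
          - a 1 * ppi p 1 v + (\<Sum>j=2..m. (a (j - 1) - a j) * ppi p j v) +
          depot_block p x z v +
          (\<Sum>j=2..m. travel_block p z j v) +
          (\<Sum>j=2..m. service_block p x z j v)) \<and>
     (\<forall>k\<in>{2..N + 1}. \<forall>v\<in>{k..N + 2}. let m = min v (N + 1) in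
        (\<Sum>j=k..v. beta z j) \<ge>
          (\<Sum>j=k..m. (a (j - 1) - a j) * ppi p j v) +
          (\<Sum>j=k..m. service_block p x z j v) +
          (\<Sum>j=k..m. travel_block p z j v)) \<and>
     beta z (N + 2) \<ge> 0)"

definition positive_part_constraints :: "dhras \<Rightarrow> milp_vars \<Rightarrow> bool" where
  "positive_part_constraints p z \<longleftrightarrow> (let N = customers p in
     (\<forall>i\<in>{1..N}. \<forall>v\<in>{1..N + 2}.
        gamma z 0 i 1 v \<ge> 0 \<and> gamma z 0 i 1 v \<ge> ppi p 1 v + travel_cost p - alpha z 0 i) \<and>
     (\<forall>i\<in>{1..N}. \<forall>i'\<in>{1..N} - {i}. \<forall>j\<in>{2..N + 1}. \<forall>v\<in>{j..N + 2}.
        gamma z i i' j v \<ge> 0 \<and> gamma z i i' j v \<ge> ppi p j v + travel_cost p - alpha z i i') \<and>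
     (\<forall>i\<in>{1..N}. \<forall>j\<in>{2..N + 1}. \<forall>v\<in>{j..N + 2}.
        delta z i j v \<ge> 0 \<and> delta z i j v \<ge> ppi p j v - rho z i))"

definition mccormick_constraints ::
  "dhras \<Rightarrow> (nat \<Rightarrow> nat \<Rightarrow> real) \<Rightarrow> milp_vars \<Rightarrow> bool" where
  "mccormick_constraints p x z \<longleftrightarrow> (let N = customers p in
     (\<forall>i\<in>{1..N}. \<forall>i'\<in>{1..N} - {i}. \<forall>j\<in>{2..N + 1}.
        tau z i i' j \<ge> x i (j - 1) + x i' j - 1 \<and> tau z i i' j \<ge> 0 \<and>
        tau z i i' j \<le> x i (j - 1) \<and> tau z i i' j \<le> x i' j \<and>
        alpha_lo p i i' * tau z i i' j \<le> eta z i i' j \<and>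
        eta z i i' j \<le> alpha_hi p i i' * tau z i i' j \<and>
        alpha z i i' + alpha_hi p i i' * (tau z i i' j - 1) \<le> eta z i i' j \<and>
        eta z i i' j \<le> alpha z i i' + alpha_lo p i i' * (tau z i i' j - 1)) \<and>
     (\<forall>i\<in>{1..N}.
        alpha_lo p 0 i * x i 1 \<le> psi z i \<and> psi z i \<le> alpha_hi p 0 i * x i 1 \<and>
        alpha z 0 i + alpha_hi p 0 i * (x i 1 - 1) \<le> psi z i \<and>
        psi z i \<le> alpha z 0 i + alpha_lo p 0 i * (x i 1 - 1)) \<and>
     (\<forall>i\<in>{1..N}. \<forall>i'\<in>{1..N} - {i}. \<forall>j\<in>{2..N + 1}. \<forall>v\<in>{j..N + 2}.
        phi z i i' j v \<ge> gamma z i i' j v + gamma_hi p i i' j v * (tau z i i' j - 1) \<and>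
        phi z i i' j v \<ge> 0 \<and>
        phi z i i' j v \<le> gamma_hi p i i' j v * tau z i i' j \<and>
        phi z i i' j v \<le> gamma z i i' j v) \<and>
     (\<forall>i\<in>{1..N}. \<forall>v\<in>{1..N + 2}.
        sigma z i v \<ge> gamma z 0 i 1 v + gamma_hi p 0 i 1 v * (x i 1 - 1) \<and>
        sigma z i v \<ge> 0 \<and>
        sigma z i v \<le> gamma_hi p 0 i 1 v * x i 1 \<and>
        sigma z i v \<le> gamma z 0 i 1 v) \<and>
     (\<forall>i\<in>{1..N}. \<forall>j\<in>{2..N + 1}. \<forall>v\<in>{j..N + 2}.
        xi z i j v \<ge> delta z i j v + delta_hi p i j v * (x i (j - 1) - 1) \<and>
        xi z i j v \<ge> 0 \<and>
        xi z i j v \<le> delta z i j v \<and>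
        xi z i j v \<le> delta_hi p i j v * x i (j - 1)) \<and>
     (\<forall>i\<in>{1..N}. \<forall>j\<in>{2..N + 1}.
        rho_lo p i * x i (j - 1) \<le> zeta z i j \<and> zeta z i j \<le> rho_hi p i * x i (j - 1) \<and>
        rho z i + rho_hi p i * (x i (j - 1) - 1) \<le> zeta z i j \<and>
        zeta z i j \<le> rho z i + rho_lo p i * (x i (j - 1) - 1)))"

definition milp_feasible ::
  "dhras \<Rightarrow> ((nat \<Rightarrow> nat \<Rightarrow> real) \<times> (nat \<Rightarrow> real) \<times> milp_vars) set" where
  "milp_feasible p = {(x, a, z). x \<in> assignments p \<and> a \<in> schedules p \<and>
     epigraph_constraints p x a z \<and> positive_part_constraints p z \<and> mccormick_constraints p x z}"

(* Optimal values are infima in the extended reals; optimality of a point is is_arg_min. *)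

definition dhras_value :: "dhras \<Rightarrow> ereal" where
  "dhras_value p = (INF (x, a) \<in> assignments p \<times> schedules p. worst_case p x a)"

definition milp_value :: "dhras \<Rightarrow> ereal" where
  "milp_value p = (INF (x, a, z) \<in> milp_feasible p. ereal (milp_objective p x z))"

definition dhras_optimal :: "dhras \<Rightarrow> (nat \<Rightarrow> nat \<Rightarrow> real) \<Rightarrow> (nat \<Rightarrow> real) \<Rightarrow> bool" where
  "dhras_optimal p x a \<longleftrightarrow>
     is_arg_min (\<lambda>(x, a). worst_case p x a) (\<lambda>y. y \<in> assignments p \<times> schedules p) (x, a)"

definition milp_optimal ::
  "dhras \<Rightarrow> (nat \<Rightarrow> nat \<Rightarrow> real) \<Rightarrow> (nat \<Rightarrow> real) \<Rightarrow> milp_vars \<Rightarrow> bool" where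
  "milp_optimal p x a z \<longleftrightarrow>
     is_arg_min (\<lambda>(x, a, z). milp_objective p x z) (\<lambda>y. y \<in> milp_feasible p) (x, a, z)"

end

(* For a fixed assignment (a permutation s of the customers) and schedule, the recourse program is
   solved by the greedy waiting times, and complementary slackness gives a dual solution that is
   constant up to accumulated waiting costs on the blocks between two idle positions.  So the
   recourse value is a maximum, over the sets of block ends, of functions that are affine in the
   scenario with slopes in the intervals that bound alpha and rho.

   The moment problem is dualised with multipliers for the means.  A finitely supported
   distribution with a wrong mean can be moved coordinatewise inside the box to the right mean at
   a price given by these slope intervals, so a sandwich argument, one coordinate at a time,
   produces optimal multipliers that already satisfy the bounds (in particular they are attained).
   The inner maximum over the scenario box separates over positions, and the remaining maximum
   over block ends is a longest path problem whose dual potentials are the partial sums of beta.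
   As x is binary, the McCormick inequalities force each linearization variable to be its product. *)

theory Submission
  imports Defs
begin

subsection \<open>Block ends and potentials\<close>

text \<open>Optimal solutions, and not only optimal values, have to correspond. Hence for every
  single decision the program must attain the worst case exactly, and with multipliers inside the
  McCormick bounds, because a binary \<open>x\<close> leaves room for no others. General duality for
  moment problems does not deliver this: the mean may lie on the boundary of the support box, and
  the box may be degenerate, so that no interior point guarantees dual attainment. What replaces the
  interior point is that the slopes of the recourse value are known in advance, which makes the
  penalty for a wrong mean exact even at boundary means. Arbitrary distributions of the ambiguity
  set enter only through weak duality. The return trip to the depot has slope
  \<open>travel_cost p\<close> in every affine piece, so it is split off with a fixed multiplier
  from the beginning.\<close>

definition next_end :: "nat \<Rightarrow> nat set \<Rightarrow> nat \<Rightarrow> nat" where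
  "next_end n D j = (LEAST v. j \<le> v \<and> (v \<in> D \<or> v = n))"

lemma next_end_mem: "j \<in> D \<or> j = n \<Longrightarrow> next_end n D j = j"
  unfolding next_end_def by (rule Least_equality) auto

lemma next_end_Suc:
  assumes "j \<notin> D" "j \<noteq> n"
  shows "next_end n D j = next_end n D (Suc j)"
proof -
  have "(\<lambda>v. j \<le> v \<and> (v \<in> D \<or> v = n)) = (\<lambda>v. Suc j \<le> v \<and> (v \<in> D \<or> v = n))"
    using assms by (auto simp: fun_eq_iff Suc_le_eq le_less)
  then show ?thesis
    unfolding next_end_def by (rule arg_cong)
qed

lemma next_end_bounds:
  assumes "j \<le> n"
  shows "j \<le> next_end n D j" "next_end n D j \<le> n" "next_end n D j \<in> D \<or> next_end n D j = n"
proof -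
  have "j \<le> next_end n D j \<and> (next_end n D j \<in> D \<or> next_end n D j = n)"
    unfolding next_end_def by (rule LeastI[of _ n]) (use assms in auto)
  then show "j \<le> next_end n D j" "next_end n D j \<in> D \<or> next_end n D j = n" by auto
  show "next_end n D j \<le> n"
    unfolding next_end_def by (rule Least_le) (use assms in auto)
qed

lemma next_end_between:
  assumes "j \<le> n" "j \<le> i" "i \<le> next_end n D j"
  shows "next_end n D i = next_end n D j"
  unfolding next_end_def[of n D i]
proof (rule Least_equality)
  show "i \<le> next_end n D j \<and> (next_end n D j \<in> D \<or> next_end n D j = n)"
    using assms next_end_bounds(3)[of j n D] by auto
next
  fix v assume "i \<le> v \<and> (v \<in> D \<or> v = n)"
  then show "next_end n D j \<le> v"
    unfolding next_end_def using assms by (intro Least_le) auto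
qed

text \<open>\<open>n\<close> closes the last block whether or not it belongs to \<open>D\<close>.
  This reconciles two index ranges: the longest path problem lets \<open>D\<close> range over
  subsets of \<open>{1..N + 2}\<close>, whereas a dual solution comes from a member of
  \<open>ends\<close>.\<close>

lemma next_end_Diff: "next_end n (D - {n}) = next_end n D"
  unfolding next_end_def by (intro ext arg_cong[of _ _ Least]) auto

lemma sum_split_at:
  fixes f :: "nat \<Rightarrow> real"
  assumes "k \<le> v" "v \<le> n"
  shows "(\<Sum>j=k..n. f j) = (\<Sum>j=k..v. f j) + (\<Sum>j=Suc v..n. f j)"
proof -
  have "{k..n} = {k..v} \<union> {Suc v..n}" using assms by auto
  then show ?thesis by (simp add: sum.union_disjoint)
qed

lemma sum_from_1: "(\<Sum>j=1..n + 1. h j) = h 1 + (\<Sum>j=2..n + 1. h j)" for h :: "nat \<Rightarrow> real"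
  by (simp add: sum.atLeast_Suc_atMost numeral_2_eq_2 del: sum.cl_ivl_Suc)

text \<open>Easy half of the path duality: cut off the block that starts at \<open>k\<close>, on
  which \<open>next_end\<close> is constant, apply the interval inequality to it, and continue
  behind its end.\<close>

lemma block_sums_le:
  fixes g :: "nat \<Rightarrow> nat \<Rightarrow> real"
  assumes "\<And>k v. 1 \<le> k \<Longrightarrow> k \<le> v \<Longrightarrow> v \<le> n \<Longrightarrow> (\<Sum>j=k..v. g j v) \<le> (\<Sum>j=k..v. b j)"
    and "1 \<le> k"
  shows "(\<Sum>j=k..n. g j (next_end n D j)) \<le> (\<Sum>j=k..n. b j)"
  using assms(2)
proof (induction "Suc n - k" arbitrary: k rule: less_induct)
  case less
  show ?case
  proof (cases "k \<le> n")
    case True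
    define v where "v = next_end n D k"
    have v: "k \<le> v" "v \<le> n"
      unfolding v_def using next_end_bounds[OF True] by auto
    have "(\<Sum>j=k..v. g j (next_end n D j)) = (\<Sum>j=k..v. g j v)"
    proof (rule sum.cong)
      fix j assume "j \<in> {k..v}"
      then have "next_end n D j = v"
        unfolding v_def by (intro next_end_between[OF True]) auto
      then show "g j (next_end n D j) = g j v" by simp
    qed simp
    also have "\<dots> \<le> (\<Sum>j=k..v. b j)"
      using assms(1) less.prems v by blast
    finally have "(\<Sum>j=k..v. g j (next_end n D j)) \<le> (\<Sum>j=k..v. b j)" .
    moreover have "(\<Sum>j=Suc v..n. g j (next_end n D j)) \<le> (\<Sum>j=Suc v..n. b j)"
      by (rule less.hyps) (use v True in auto)
    ultimately show ?thesis
      unfolding sum_split_at[OF v] by (rule add_mono)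
  qed simp
qed

text \<open>The potentials are the differences of the longest path values over the block ends.\<close>

lemma block_potentials:
  fixes g :: "nat \<Rightarrow> nat \<Rightarrow> real"
  assumes "\<And>D. D \<subseteq> {1..n} \<Longrightarrow> (\<Sum>j=1..n. g j (next_end n D j)) \<le> W"
  obtains b where
    "\<And>k v. 1 \<le> k \<Longrightarrow> k \<le> v \<Longrightarrow> v \<le> n \<Longrightarrow> (\<Sum>j=k..v. g j v) \<le> (\<Sum>j=k..v. b j)"
    "(\<Sum>j=1..n. b j) \<le> W"
proof -
  define H where "H k D = (\<Sum>j=k..n. g j (next_end n D j))" for k D
  \<comment> \<open>Ends below \<open>k\<close> do not affect \<open>H k D\<close>, so every tail
    can be maximised over the same family of sets.\<close>
  define h where "h k = Max (H k ` Pow {1..n})" for k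
  have h_ge: "H k D \<le> h k" if "D \<subseteq> {1..n}" for k D
    unfolding h_def using that by (intro Max_ge) auto
  have h_attained: "\<exists>D. D \<subseteq> {1..n} \<and> h k = H k D" for k
  proof -
    have "h k \<in> H k ` Pow {1..n}"
      unfolding h_def by (rule Max_in) auto
    then show ?thesis by auto
  qed
  have h_end: "h (Suc n) = 0"
  proof -
    obtain D where "h (Suc n) = H (Suc n) D" using h_attained by blast
    then show ?thesis by (simp add: H_def)
  qed
  define b where "b k = h k - h (Suc k)" for k
  have tele: "(\<Sum>j=k..v. b j) = h k - h (Suc v)" if "k \<le> Suc v" for k v
    using that sum_Suc_diff[of k v "\<lambda>j. - h j"] by (simp add: b_def)
  have step: "(\<Sum>j=k..v. g j v) + h (Suc v) \<le> h k" if kv: "1 \<le> k" "k \<le> v" "v \<le> n" for k v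
  proof -
    obtain D where D: "D \<subseteq> {1..n}" "h (Suc v) = H (Suc v) D" using h_attained by blast
    \<comment> \<open>\<open>{k..v}\<close> becomes a single block, followed by a partition that is
      optimal behind \<open>v\<close>. Comparing it with \<open>h k\<close> is the Bellman
      inequality for this block.\<close>
    define D' where "D' = insert v (D \<inter> {Suc v..})"
    have low: "next_end n D' j = v" if "k \<le> j" "j \<le> v" for j
      unfolding next_end_def by (rule Least_equality) (use that kv in \<open>auto simp: D'_def\<close>)
    have high: "next_end n D' j = next_end n D j" if "Suc v \<le> j" for j
    proof -
      have "(\<lambda>u. j \<le> u \<and> (u \<in> D' \<or> u = n)) = (\<lambda>u. j \<le> u \<and> (u \<in> D \<or> u = n))"
        using that by (auto simp: D'_def fun_eq_iff)
      then show ?thesis unfolding next_end_def by (rule arg_cong)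
    qed
    have "H k D' = (\<Sum>j=k..v. g j v) + H (Suc v) D"
      unfolding H_def sum_split_at[OF kv(2,3)] by (simp add: low high)
    moreover have "H k D' \<le> h k"
      by (rule h_ge) (use D kv in \<open>auto simp: D'_def\<close>)
    ultimately show ?thesis using D by simp
  qed
  show thesis
  proof (rule that[of b])
    show "(\<Sum>j=k..v. g j v) \<le> (\<Sum>j=k..v. b j)" if "1 \<le> k" "k \<le> v" "v \<le> n" for k v
      using step[OF that] tele[of k v] that by simp
    obtain D where "D \<subseteq> {1..n}" "h 1 = H 1 D" using h_attained by blast
    then show "(\<Sum>j=1..n. b j) \<le> W"
      using tele[of 1 n] h_end assms[of D] by (simp add: H_def)
  qed
qed

subsection \<open>Multipliers in a box\<close>

text \<open>Points with \<open>z > 0\<close> bound the slope from below by \<open>r / z\<close>,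
  points with \<open>z < 0\<close> bound it from above. \<open>cross\<close> says that every such
  lower bound is at most every such upper bound, and \<open>bound\<close> makes both compatible with
  the interval from \<open>l\<close> to \<open>h\<close>. At \<open>z = 0\<close> the claim is
  \<open>bound\<close> itself.\<close>

lemma separating_slope:
  fixes R :: "(real \<times> real) set"
  assumes bound: "\<And>z r. (z, r) \<in> R \<Longrightarrow> r \<le> max (l * z) (h * z)"
    and cross: "\<And>z r z' r'. (z, r) \<in> R \<Longrightarrow> (z', r') \<in> R \<Longrightarrow> z > 0 \<Longrightarrow> z' < 0 \<Longrightarrow>
      r * (- z') + r' * z \<le> 0"
    and "l \<le> h"
  obtains c where "l \<le> c" "c \<le> h" "\<And>z r. (z, r) \<in> R \<Longrightarrow> r \<le> c * z"
proof -
  \<comment> \<open>\<open>l\<close> is inserted so that the supremum exists even without points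
    with \<open>z > 0\<close>, and is at least \<open>l\<close>.\<close>
  define Q where "Q = insert l {r / z | z r. (z, r) \<in> R \<and> z > 0}"
  have Q_h: "q \<le> h" if q: "q \<in> Q" for q
  proof (cases "q = l")
    case False
    then obtain z r where zr: "q = r / z" "(z, r) \<in> R" "z > 0"
      using q by (auto simp: Q_def)
    have "max (l * z) (h * z) = h * z"
      using zr(3) \<open>l \<le> h\<close> by (simp add: max_def)
    then show ?thesis
      using bound[OF zr(2)] zr by (simp add: divide_le_eq)
  qed (use \<open>l \<le> h\<close> in simp)
  have Q_neg: "q \<le> r' / z'" if q: "q \<in> Q" and "(z', r') \<in> R" "z' < 0" for q z' r'
  proof (cases "q = l")
    case True
    have "max (l * z') (h * z') = l * z'"
      using that(3) \<open>l \<le> h\<close> by (simp add: max_def mult_le_cancel_right)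
    then show ?thesis
      using bound[OF that(2)] that True by (simp add: neg_le_divide_eq)
  next
    case False
    then obtain z r where zr: "q = r / z" "(z, r) \<in> R" "z > 0"
      using q by (auto simp: Q_def)
    have "r' * z \<le> (q * z) * z'"
      using cross[OF zr(2) that(2) zr(3) that(3)] zr by (simp add: algebra_simps)
    then have "r' * z \<le> (q * z') * z" by (simp add: algebra_simps)
    then show ?thesis
      using zr(3) that(3) by (simp add: neg_le_divide_eq)
  qed
  have Q_bdd: "bdd_above Q" using Q_h by (auto simp: bdd_above_def)
  have Q_ne: "Q \<noteq> {}" by (auto simp: Q_def)
  show thesis
  proof (rule that[of "Sup Q"])
    show "l \<le> Sup Q" by (rule cSup_upper[OF _ Q_bdd]) (simp add: Q_def)
    show "Sup Q \<le> h" by (rule cSup_least[OF Q_ne Q_h])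
    fix z r assume zr: "(z, r) \<in> R"
    consider "z = 0" | "z > 0" | "z < 0" by linarith
    then show "r \<le> Sup Q * z"
    proof cases
      case 1
      then show ?thesis using bound[OF zr] by simp
    next
      case 2
      then have "r / z \<le> Sup Q"
        using zr by (intro cSup_upper[OF _ Q_bdd]) (auto simp: Q_def)
      then show ?thesis using 2 by (simp add: divide_le_eq)
    next
      case 3
      then have "Sup Q \<le> r / z"
        using Q_neg zr by (intro cSup_least[OF Q_ne]) auto
      then show ?thesis using 3 by (simp add: neg_le_divide_eq)
    qed
  qed
qed

text \<open>A sandwich theorem for a concave hypograph below the support function of a box, at the
  origin: the supporting functional is built one coordinate at a time, so that no topology on the
  space of coordinates is needed and the bounds on the multipliers come for free.\<close>

lemma box_multipliers:
  fixes K :: "(('e \<Rightarrow> real) \<times> real) set"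
  assumes "finite E"
    and "\<And>m s m' s' \<theta>. (m, s) \<in> K \<Longrightarrow> (m', s') \<in> K \<Longrightarrow> 0 \<le> \<theta> \<Longrightarrow> \<theta> \<le> 1 \<Longrightarrow>
      ((\<lambda>e. (1 - \<theta>) * m e + \<theta> * m' e), (1 - \<theta>) * s + \<theta> * s') \<in> K"
    and "\<And>e. e \<in> E \<Longrightarrow> l e \<le> h e"
    and "\<And>m s. (m, s) \<in> K \<Longrightarrow> s \<le> (\<Sum>e\<in>E. max (l e * m e) (h e * m e))"
  shows "\<exists>c. (\<forall>e\<in>E. l e \<le> c e \<and> c e \<le> h e) \<and> (\<forall>m s. (m, s) \<in> K \<longrightarrow> s \<le> (\<Sum>e\<in>E. c e * m e))"
  using assms
proof (induction E arbitrary: K rule: finite_induct)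
  case empty
  then show ?case by auto
next
  case (insert e E)
  note conv = insert.prems(1) and lh = insert.prems(2) and sup = insert.prems(3)
  define S where "S m = (\<Sum>e\<in>E. max (l e * m e) (h e * m e))" for m
  have S_conv: "S (\<lambda>e. (1 - \<theta>) * m e + \<theta> * m' e) \<le> (1 - \<theta>) * S m + \<theta> * S m'"
    if th: "0 \<le> \<theta>" "\<theta> \<le> 1" for \<theta> m m'
    unfolding S_def sum_distrib_left sum.distrib[symmetric]
  proof (rule sum_mono)
    fix e
    have m1: "(1 - \<theta>) * y \<le> (1 - \<theta>) * max y z \<and> (1 - \<theta>) * z \<le> (1 - \<theta>) * max y z" for y z
      using th by (auto intro: mult_left_mono)
    have m2: "\<theta> * y \<le> \<theta> * max y z \<and> \<theta> * z \<le> \<theta> * max y z" for y z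
      using th by (auto intro: mult_left_mono)
    have "l e * ((1 - \<theta>) * m e + \<theta> * m' e) = (1 - \<theta>) * (l e * m e) + \<theta> * (l e * m' e)"
      "h e * ((1 - \<theta>) * m e + \<theta> * m' e) = (1 - \<theta>) * (h e * m e) + \<theta> * (h e * m' e)"
      by (simp_all add: algebra_simps)
    then show "max (l e * ((1 - \<theta>) * m e + \<theta> * m' e)) (h e * ((1 - \<theta>) * m e + \<theta> * m' e))
      \<le> (1 - \<theta>) * max (l e * m e) (h e * m e) + \<theta> * max (l e * m' e) (h e * m' e)"
      using m1[of "l e * m e" "h e * m e"] m2[of "l e * m' e" "h e * m' e"] by linarith
  qed
  \<comment> \<open>Charging all other coordinates at their full support function leaves a problem
    in the coordinate \<open>e\<close> alone.\<close>
  define R where "R = {(m e, s - S m) | m s. (m, s) \<in> K}"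
  obtain c where c: "l e \<le> c" "c \<le> h e" "\<And>z r. (z, r) \<in> R \<Longrightarrow> r \<le> c * z"
  proof (rule separating_slope[of R "l e" "h e"])
    show "l e \<le> h e" using lh by simp
    show "r \<le> max (l e * z) (h e * z)" if "(z, r) \<in> R" for z r
      using that sup insert.hyps by (force simp: R_def S_def)
  next
    fix z r z' r' assume R: "(z, r) \<in> R" "(z', r') \<in> R" "z > 0" "z' < 0"
    obtain m s where m: "(m, s) \<in> K" "z = m e" "r = s - S m" using R by (auto simp: R_def)
    obtain m' s' where m': "(m', s') \<in> K" "z' = m' e" "r' = s' - S m'" using R by (auto simp: R_def)
    \<comment> \<open>This weight cancels the coordinate \<open>e\<close> of the mixture, so that
      its term in the support function is zero and the convexity of \<open>S\<close> bounds the
      rest.\<close>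
    define \<theta> where "\<theta> = z / (z - z')"
    have th: "0 \<le> \<theta>" "\<theta> \<le> 1" "1 - \<theta> = - z' / (z - z')"
      using R by (auto simp: \<theta>_def divide_simps)
    have zero: "(1 - \<theta>) * m e + \<theta> * m' e = 0"
      using R unfolding th(3) by (simp add: \<theta>_def m(2) m'(2) divide_simps)
    have "(1 - \<theta>) * s + \<theta> * s' \<le> S (\<lambda>e. (1 - \<theta>) * m e + \<theta> * m' e)"
      using sup[OF conv[OF m(1) m'(1) th(1,2)]] insert.hyps zero by (simp add: S_def)
    also have "\<dots> \<le> (1 - \<theta>) * S m + \<theta> * S m'" using S_conv th by blast
    finally have "(1 - \<theta>) * r + \<theta> * r' \<le> 0"
      by (simp add: m(3) m'(3) algebra_simps)
    moreover have "(1 - \<theta>) * r + \<theta> * r' = (r * (- z') + r' * z) / (z - z')"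
      unfolding th(3) by (simp add: \<theta>_def add_divide_distrib algebra_simps diff_divide_distrib)
    ultimately show "r * (- z') + r' * z \<le> 0"
      using R by (simp add: divide_le_0_iff)
  qed blast
  \<comment> \<open>The slope for \<open>e\<close> is now fixed. By the choice of \<open>c\<close>,
    the remaining values lie below the support function over \<open>E\<close>, as the induction
    hypothesis requires.\<close>
  define K' where "K' = {(m, s - c * m e) | m s. (m, s) \<in> K}"
  have "\<exists>c'. (\<forall>e\<in>E. l e \<le> c' e \<and> c' e \<le> h e) \<and>
      (\<forall>m s. (m, s) \<in> K' \<longrightarrow> s \<le> (\<Sum>e\<in>E. c' e * m e))"
  proof (rule insert.IH)
    fix m s m' s' \<theta> assume "(m, s) \<in> K'" "(m', s') \<in> K'" and th: "0 \<le> \<theta>" "\<theta> \<le> (1::real)"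
    then obtain r r' where r: "(m, r) \<in> K" "s = r - c * m e" "(m', r') \<in> K" "s' = r' - c * m' e"
      by (auto simp: K'_def)
    have "(1 - \<theta>) * s + \<theta> * s' =
        ((1 - \<theta>) * r + \<theta> * r') - c * ((1 - \<theta>) * m e + \<theta> * m' e)"
      by (simp add: r algebra_simps)
    then show "((\<lambda>e. (1 - \<theta>) * m e + \<theta> * m' e), (1 - \<theta>) * s + \<theta> * s') \<in> K'"
      unfolding K'_def using conv[OF r(1,3) th] by auto
  next
    fix m s assume "(m, s) \<in> K'"
    then obtain r where r: "(m, r) \<in> K" "s = r - c * m e" by (auto simp: K'_def)
    have "r - S m \<le> c * m e" by (rule c(3)) (use r in \<open>auto simp: R_def\<close>)
    then show "s \<le> (\<Sum>e\<in>E. max (l e * m e) (h e * m e))" using r by (simp add: S_def)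
  qed (use lh in auto)
  then obtain c' where c': "\<And>e. e \<in> E \<Longrightarrow> l e \<le> c' e \<and> c' e \<le> h e"
    "\<And>m s. (m, s) \<in> K' \<Longrightarrow> s \<le> (\<Sum>e\<in>E. c' e * m e)" by blast
  show ?case
  proof (intro exI[of _ "c'(e := c)"] conjI allI impI ballI)
    fix m s assume "(m, s) \<in> K"
    then have "s - c * m e \<le> (\<Sum>e\<in>E. c' e * m e)" by (intro c') (auto simp: K'_def)
    moreover have "(\<Sum>i\<in>E. (c'(e := c)) i * m i) = (\<Sum>e\<in>E. c' e * m e)"
      by (rule sum.cong) (use insert.hyps in auto)
    ultimately show "s \<le> (\<Sum>i\<in>insert e E. (c'(e := c)) i * m i)"
      using insert.hyps by simp
  qed (use c c' in auto)
qed

text \<open>Contract the interval towards the endpoint on the side where the mean is missing. The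
  map is affine, so it moves the expectation of a random variable exactly as it moves
  \<open>m\<close>, and it shifts all points in the same direction.\<close>

lemma affine_recentring:
  fixes lo hi m \<mu> :: real
  assumes "lo \<le> m" "m \<le> hi" "lo \<le> \<mu>" "\<mu> \<le> hi"
  shows "\<exists>A B. A + B * m = \<mu> \<and>
    (\<forall>r. lo \<le> r \<and> r \<le> hi \<longrightarrow> lo \<le> A + B * r \<and> A + B * r \<le> hi) \<and>
    ((\<forall>r. lo \<le> r \<and> r \<le> hi \<longrightarrow> r \<le> A + B * r) \<or>
     (\<forall>r. lo \<le> r \<and> r \<le> hi \<longrightarrow> A + B * r \<le> r))"
proof -
  define c where "c = (if m \<le> \<mu> then hi else lo)"
  \<comment> \<open>If \<open>c = m\<close>, then also \<open>\<mu> = m\<close>, and division by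
    zero gives the correct weight 0.\<close>
  define \<theta> where "\<theta> = (\<mu> - m) / (c - m)"
  have th: "0 \<le> \<theta>" "\<theta> \<le> 1" "\<theta> * (c - m) = \<mu> - m"
    using assms by (auto simp: \<theta>_def c_def divide_simps)
  have c: "lo \<le> c" "c \<le> hi" using assms by (auto simp: c_def)
  have eq: "\<theta> * c + (1 - \<theta>) * r = r + \<theta> * (c - r)" for r by (simp add: algebra_simps)
  show ?thesis
  proof (rule exI[of _ "\<theta> * c"], rule exI[of _ "1 - \<theta>"], intro conjI)
    show "\<theta> * c + (1 - \<theta>) * m = \<mu>" using th(3) by (simp add: eq)
    have "lo \<le> \<theta> * c + (1 - \<theta>) * r \<and> \<theta> * c + (1 - \<theta>) * r \<le> hi" if "lo \<le> r" "r \<le> hi" for r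
      using convex_bound_le[of c hi r \<theta> "1 - \<theta>"] convex_bound_le[of "-c" "-lo" "-r" \<theta> "1 - \<theta>"]
        that th c by simp
    then show "\<forall>r. lo \<le> r \<and> r \<le> hi \<longrightarrow>
        lo \<le> \<theta> * c + (1 - \<theta>) * r \<and> \<theta> * c + (1 - \<theta>) * r \<le> hi" by blast
    show "(\<forall>r. lo \<le> r \<and> r \<le> hi \<longrightarrow> r \<le> \<theta> * c + (1 - \<theta>) * r) \<or>
      (\<forall>r. lo \<le> r \<and> r \<le> hi \<longrightarrow> \<theta> * c + (1 - \<theta>) * r \<le> r)"
      unfolding eq using th by (auto simp: c_def mult_le_0_iff)
  qed
qed

text \<open>A Bernoulli choice between the two distributions. It supplies the convexity of the set
  of attainable pairs of moments and values.\<close>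

lemma pmf_mixture:
  fixes q1 q2 :: "'b pmf"
  assumes "finite (set_pmf q1)" "finite (set_pmf q2)" "0 \<le> \<theta>" "\<theta> \<le> 1"
    "set_pmf q1 \<subseteq> S" "set_pmf q2 \<subseteq> S"
  obtains q where "finite (set_pmf q)" "set_pmf q \<subseteq> S"
    "\<And>f :: 'b \<Rightarrow> real. measure_pmf.expectation q f =
       (1 - \<theta>) * measure_pmf.expectation q1 f + \<theta> * measure_pmf.expectation q2 f"
proof -
  define q where "q = bind_pmf (bernoulli_pmf \<theta>) (\<lambda>b. if b then q2 else q1)"
  have fin: "finite (set_pmf (if b then q2 else q1))" for b using assms by auto
  show thesis
  proof (rule that[of q])
    show "finite (set_pmf q)" unfolding q_def set_bind_pmf using fin by (intro finite_UN_I) auto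
    show "set_pmf q \<subseteq> S" unfolding q_def set_bind_pmf using assms by (auto split: if_splits)
    fix f :: "'b \<Rightarrow> real"
    have "measure_pmf.expectation q f =
      (\<Sum>b\<in>UNIV. pmf (bernoulli_pmf \<theta>) b *\<^sub>R measure_pmf.expectation (if b then q2 else q1) f)"
      unfolding q_def by (rule pmf_expectation_bind) (use fin in auto)
    then show "measure_pmf.expectation q f =
       (1 - \<theta>) * measure_pmf.expectation q1 f + \<theta> * measure_pmf.expectation q2 f"
      using assms by (simp add: UNIV_bool)
  qed
qed

subsection \<open>Duality for the recourse program\<close>

lemma sum_single:
  fixes h :: "'b \<Rightarrow> real"
  assumes "finite A" "c \<in> A" "\<And>i. i \<in> A \<Longrightarrow> i \<noteq> c \<Longrightarrow> h i = 0"
  shows "sum h A = h c"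
  using sum.mono_neutral_right[of A "{c}" h] assms by auto

lemma sum_by_parts:
  fixes y w :: "nat \<Rightarrow> real"
  assumes "w 0 = 0"
  shows "(\<Sum>j=1..M. y j * (w j - w (j - 1))) = (\<Sum>j=1..M. (y j - y (Suc j)) * w j) + y (Suc M) * w M"
proof (induction M)
  case (Suc M)
  then show ?case by (simp add: algebra_simps)
qed (simp add: assms)

text \<open>Lindley's recursion for waiting times. Position 0 is fictitious and has no waiting time,
  which gives the first constraint the same shape as the others.\<close>

primrec greedy_wait :: "(nat \<Rightarrow> real) \<Rightarrow> nat \<Rightarrow> real" where
  "greedy_wait b 0 = 0"
| "greedy_wait b (Suc j) = max 0 (greedy_wait b j + b (Suc j))"

lemma ppi_self: "ppi p j j = - cu p j"
  by (simp add: ppi_def)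

lemma ppi_step: "j < v \<Longrightarrow> ppi p j v = cw p j + ppi p (Suc j) v"
  by (simp add: ppi_def sum.atLeast_Suc_lessThan)

locale dhras_data =
  fixes p :: dhras
  assumes customers_pos: "customers p \<ge> 1"
    and costs_nonneg: "\<And>j. j \<in> {1..customers p} \<Longrightarrow> wait_cost p j \<ge> 0 \<and> idle_cost p j \<ge> 0"
    and over_cost_nonneg: "over_cost p \<ge> 0"
    and travel_cost_nonneg: "travel_cost p \<ge> 0"
    and d_lo_nonneg: "\<And>i. i \<in> {1..customers p} \<Longrightarrow> d_lo p i \<ge> 0"
    and t_lo_nonneg: "\<And>i i'. (i, i') \<in> arcs p \<Longrightarrow> t_lo p i i' \<ge> 0"
    and ambiguity_nonempty: "ambiguity_set p \<noteq> {}"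
    and idle_cost_step:
      "\<And>j. j \<in> {1..<customers p} \<Longrightarrow> idle_cost p (j + 1) \<le> idle_cost p j + wait_cost p j"
begin

abbreviation N :: nat where "N \<equiv> customers p"

abbreviation ends :: "nat set set" where "ends \<equiv> Pow {1..N + 1}"

lemma cw_nonneg: "1 \<le> j \<Longrightarrow> 0 \<le> cw p j"
  using costs_nonneg[of j] over_cost_nonneg by (auto simp: cw_def)

lemma cu_nonneg: "1 \<le> j \<Longrightarrow> 0 \<le> cu p j"
  using costs_nonneg[of j] by (auto simp: cu_def)

lemma cu_step: "1 \<le> j \<Longrightarrow> cu p (Suc j) \<le> cu p j + cw p j"
  using cw_nonneg[of j] cu_nonneg[of j] idle_cost_step[of j] by (auto simp: cu_def cw_def)

text \<open>The condition on idle costs enters here: going back from \<open>v\<close>, every step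
  adds \<open>cw p j\<close>, which covers the possible increase of the idle cost from
  \<open>j\<close> to \<open>Suc j\<close>.\<close>

lemma ppi_ge: "j \<le> v \<Longrightarrow> 1 \<le> j \<Longrightarrow> - cu p j \<le> ppi p j v"
proof (induction j rule: inc_induct)
  case (step j)
  then show ?case using cu_step[of j] ppi_step[of j v p] by simp
qed (simp add: ppi_self)

text \<open>The dual solution belonging to the block ends \<open>D\<close>. The additional position
  \<open>N + 2\<close> carries the boundary value 0; a block that reaches it also collects the
  overtime cost.\<close>

definition dual :: "nat set \<Rightarrow> nat \<Rightarrow> real" where
  "dual D j = ppi p j (next_end (N + 2) D j)"

lemma dual_mem: "j \<in> D \<Longrightarrow> dual D j = - cu p j"
  by (simp add: dual_def next_end_mem ppi_self)

lemma dual_last: "dual D (N + 2) = 0"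
  by (simp add: dual_def next_end_mem ppi_self cu_def)

lemma dual_step:
  assumes "j \<notin> D" "j < N + 2"
  shows "dual D j = cw p j + dual D (Suc j)"
proof -
  have "next_end (N + 2) D j = next_end (N + 2) D (Suc j)"
    using assms by (intro next_end_Suc) auto
  moreover have "Suc j \<le> next_end (N + 2) D (Suc j)"
    using assms by (intro next_end_bounds) auto
  ultimately show ?thesis
    by (simp add: dual_def ppi_step)
qed

lemma dual_ge: "1 \<le> j \<Longrightarrow> j \<le> N + 2 \<Longrightarrow> - cu p j \<le> dual D j"
  unfolding dual_def by (intro ppi_ge next_end_bounds)

text \<open>This is the dual constraint of the variable \<open>w j\<close>. It is tight inside a
  block; at a block end the left side is \<open>- cu p j\<close>, and \<open>cu_step\<close> with
  the lower bound \<open>dual_ge\<close> at \<open>Suc j\<close> gives the inequality.\<close>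

lemma dual_le:
  assumes "1 \<le> j" "j < N + 2"
  shows "dual D j \<le> cw p j + dual D (Suc j)"
proof (cases "j \<in> D")
  case True
  then show ?thesis using cu_step[of j] dual_ge[of "Suc j" D] assms by (simp add: dual_mem)
next
  case False
  then show ?thesis using dual_step[of j D] assms by simp
qed

text \<open>Summation by parts gives \<open>w j\<close> the coefficient
  \<open>dual D j - dual D (Suc j)\<close>; the boundary term vanishes by \<open>dual_last\<close>.
  The two families of dual constraints then apply term by term.\<close>

lemma recourse_weak_duality:
  assumes w: "w 0 = 0" "\<And>j. j \<in> {1..N + 1} \<Longrightarrow> 0 \<le> w j \<and> 0 \<le> u j"
    and b: "\<And>j. j \<in> {1..N + 1} \<Longrightarrow> b j = w j - w (j - 1) - u j"
  shows "(\<Sum>j=1..N + 1. dual D j * b j) \<le> (\<Sum>j=1..N + 1. cw p j * w j + cu p j * u j)"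
proof -
  have "(\<Sum>j=1..N + 1. dual D j * b j) =
      (\<Sum>j=1..N + 1. dual D j * (w j - w (j - 1))) - (\<Sum>j=1..N + 1. dual D j * u j)"
    unfolding sum_subtractf[symmetric] by (rule sum.cong) (simp_all only: b algebra_simps)
  also have "\<dots> = (\<Sum>j=1..N + 1. (dual D j - dual D (Suc j)) * w j - dual D j * u j)"
    using sum_by_parts[of w "dual D" "N + 1", OF w(1)] dual_last[of D]
    by (simp add: sum_subtractf del: sum.cl_ivl_Suc)
  also have "\<dots> \<le> (\<Sum>j=1..N + 1. cw p j * w j + cu p j * u j)"
  proof (rule sum_mono)
    fix j assume j: "j \<in> {1..N + 1}"
    have "(dual D j - dual D (Suc j)) * w j \<le> cw p j * w j"
      using dual_le[of j D] w(2)[OF j] j by (intro mult_right_mono) auto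
    moreover have "- dual D j * u j \<le> cu p j * u j"
      using dual_ge[of j D] w(2)[OF j] j by (intro mult_right_mono) auto
    ultimately show "(dual D j - dual D (Suc j)) * w j - dual D j * u j \<le> cw p j * w j + cu p j * u j"
      by simp
  qed
  finally show ?thesis .
qed

lemma recourse_strong_duality:
  obtains w u D where "w 0 = 0" "\<And>j. j \<in> {1..N + 1} \<Longrightarrow> 0 \<le> w j \<and> 0 \<le> u j"
    "\<And>j. j \<in> {1..N + 1} \<Longrightarrow> w j - w (j - 1) - u j = b j" "D \<in> ends"
    "(\<Sum>j=1..N + 1. cw p j * w j + cu p j * u j) = (\<Sum>j=1..N + 1. dual D j * b j)"
proof -
  define w where "w = greedy_wait b"
  define u where "u j = w j - w (j - 1) - b j" for j
  \<comment> \<open>All positions without waiting become block ends, whether or not there is idle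
    time. There only the term of \<open>u j\<close> survives, and \<open>dual D j = - cu p j\<close>
    is its price; elsewhere \<open>u j = 0\<close> and the constraint of \<open>w j\<close> is
    tight.\<close>
  define D where "D = {j \<in> {1..N + 1}. w j = 0}"
  have w_rec: "w j = max 0 (w (j - 1) + b j)" if "1 \<le> j" for j
    using that by (cases j) (auto simp: w_def)
  have nonneg: "0 \<le> w j \<and> 0 \<le> u j" if "1 \<le> j" for j
    using w_rec[OF that] by (simp add: u_def)
  have "(\<Sum>j=1..N + 1. dual D j * b j) =
      (\<Sum>j=1..N + 1. dual D j * (w j - w (j - 1))) - (\<Sum>j=1..N + 1. dual D j * u j)"
    unfolding sum_subtractf[symmetric] by (rule sum.cong) (simp_all add: u_def algebra_simps)
  also have "\<dots> = (\<Sum>j=1..N + 1. (dual D j - dual D (Suc j)) * w j - dual D j * u j)"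
    using sum_by_parts[of w "dual D" "N + 1"] dual_last[of D]
    by (simp add: sum_subtractf w_def del: sum.cl_ivl_Suc)
  also have "\<dots> = (\<Sum>j=1..N + 1. cw p j * w j + cu p j * u j)"
  proof (rule sum.cong)
    fix j assume j: "j \<in> {1..N + 1}"
    show "(dual D j - dual D (Suc j)) * w j - dual D j * u j = cw p j * w j + cu p j * u j"
    proof (cases "w j = 0")
      case True
      then show ?thesis using j dual_mem[of j D] by (simp add: D_def)
    next
      case False
      then have "u j = 0" "j \<notin> D"
        using w_rec[of j] j by (auto simp: u_def D_def max_def split: if_splits)
      then show ?thesis using dual_step[of j D] j by simp
    qed
  qed simp
  finally have eq: "(\<Sum>j=1..N + 1. dual D j * b j) = (\<Sum>j=1..N + 1. cw p j * w j + cu p j * u j)" .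
  show thesis
  proof (rule that[of w u D])
    show "(\<Sum>j=1..N + 1. cw p j * w j + cu p j * u j) = (\<Sum>j=1..N + 1. dual D j * b j)"
      using eq by (rule sym)
  qed (use nonneg in \<open>auto simp: u_def w_def D_def\<close>)
qed

lemma ppi_bounds:
  assumes "j \<in> {2..N + 1}" "v \<in> {j..N + 2}"
  shows "P1l p \<le> ppi p j v" "ppi p j v \<le> P1u p"
proof -
  have "{ppi p j v | j v. j \<in> {2..N + 1} \<and> v \<in> {j..N + 2}}
      \<subseteq> (\<lambda>(j, v). ppi p j v) ` ({2..N + 1} \<times> {..N + 2})" by auto
  then have fin: "finite {ppi p j v | j v. j \<in> {2..N + 1} \<and> v \<in> {j..N + 2}}"
    by (rule finite_subset) simp
  show "P1l p \<le> ppi p j v" unfolding P1l_def by (rule Min_le[OF fin]) (use assms in blast)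
  show "ppi p j v \<le> P1u p" unfolding P1u_def by (rule Max_ge[OF fin]) (use assms in blast)
qed

lemma ppi_1_bounds:
  assumes "v \<in> {1..N + 2}"
  shows "P2l p \<le> ppi p 1 v" "ppi p 1 v \<le> P2u p"
proof -
  have fin: "finite {ppi p 1 v | v. v \<in> {1..N + 2}}" by simp
  show "P2l p \<le> ppi p 1 v" unfolding P2l_def by (rule Min_le[OF fin]) (use assms in blast)
  show "ppi p 1 v \<le> P2u p" unfolding P2u_def by (rule Max_ge[OF fin]) (use assms in blast)
qed

end

text \<open>The customer in position \<open>j\<close> is \<open>s j\<close>, and \<open>s 0 = 0\<close> is the depot, so that \<open>(s (j - 1), s j)\<close>
  is the arc leading to position \<open>j\<close> also for \<open>j = 1\<close>.\<close>

locale dhras_decision = dhras_data +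
  fixes s :: "nat \<Rightarrow> nat" and a :: "nat \<Rightarrow> real"
  assumes s_bij: "bij_betw s {1..customers p} {1..customers p}"
    and s_0: "s 0 = 0"
    and schedule: "a \<in> schedules p"
begin

section \<open>The recourse value for one permutation and one schedule\<close>

definition x :: "nat \<Rightarrow> nat \<Rightarrow> real" where
  "x i j = (if j \<in> {1..N} \<and> i = s j then 1 else 0)"

definition travel :: "nat \<Rightarrow> scenario \<Rightarrow> real" where
  "travel j \<xi> = fst \<xi> (s (j - 1), s j)"

definition service :: "nat \<Rightarrow> scenario \<Rightarrow> real" where
  "service j \<xi> = snd \<xi> (s (j - 1))"

definition return_time :: "scenario \<Rightarrow> real" where
  "return_time \<xi> = fst \<xi> (s N, 0)"

text \<open>The return trip is omitted: its coefficient \<open>travel_cost p\<close> is the same for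
  every \<open>D\<close>, so it commutes with the maximum over \<open>D\<close>.\<close>

definition dual_value :: "nat set \<Rightarrow> scenario \<Rightarrow> real" where
  "dual_value D \<xi> = (\<Sum>j=1..N. (dual D j + travel_cost p) * travel j \<xi>) +
     (\<Sum>j=2..N + 1. dual D j * service j \<xi>) - (\<Sum>j=1..N + 1. dual D j * (a j - a (j - 1)))"

lemma s_range: "j \<in> {1..N} \<Longrightarrow> s j \<in> {1..N}"
  using s_bij by (auto simp: bij_betw_def)

lemma s_eq_iff: "i \<le> N \<Longrightarrow> j \<le> N \<Longrightarrow> s i = s j \<longleftrightarrow> i = j"
proof -
  have inj: "inj_on s {1..N}" using s_bij by (auto simp: bij_betw_def)
  assume "i \<le> N" "j \<le> N"
  then show ?thesis
    using inj_on_eq_iff[OF inj, of i j] s_range[of i] s_range[of j] s_0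
    by (cases "i = 0"; cases "j = 0") auto
qed

lemma s_pred_neq:
  assumes "j \<in> {1..N}"
  shows "s (j - 1) \<noteq> s j"
proof -
  have "j - 1 \<le> N" "j \<le> N" "j - 1 \<noteq> j" using assms by auto
  then show ?thesis using s_eq_iff by blast
qed

lemma s_le: "j \<le> N \<Longrightarrow> s j \<le> N"
  using s_range[of j] s_0 by (cases "j = 0") auto

lemma arc_in: "j \<in> {1..N} \<Longrightarrow> (s (j - 1), s j) \<in> arcs p"
  using s_le[of j] s_le[OF diff_le_self[THEN order_trans], of j 1] s_pred_neq[of j]
  by (simp add: arcs_def)

lemma return_arc_in: "(s N, 0) \<in> arcs p"
  using s_range[of N] customers_pos by (auto simp: arcs_def)

lemma sum_column:
  assumes "j \<in> {1..N}" "\<And>i. i \<in> {1..N} \<Longrightarrow> i \<noteq> s j \<Longrightarrow> h i = (0::real)"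
  shows "(\<Sum>i=1..N. h i) = h (s j)"
  using assms s_range by (intro sum_single) auto

lemma sum_arcs:
  assumes "j \<in> {2..N}" "\<And>i i'. i \<in> {1..N} \<Longrightarrow> i' \<in> {1..N} \<Longrightarrow> i \<noteq> i' \<Longrightarrow>
    i \<noteq> s (j - 1) \<or> i' \<noteq> s j \<Longrightarrow> h i i' = (0::real)"
  shows "(\<Sum>i=1..N. \<Sum>i'\<in>{1..N} - {i}. h i i') = h (s (j - 1)) (s j)"
proof -
  have "(\<Sum>i=1..N. \<Sum>i'\<in>{1..N} - {i}. h i i') = (\<Sum>i'\<in>{1..N} - {s (j - 1)}. h (s (j - 1)) i')"
    by (rule sum_column) (use assms in \<open>auto intro!: sum.neutral\<close>)
  also have "\<dots> = h (s (j - 1)) (s j)"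
  proof (rule sum_single)
    show "s j \<in> {1..N} - {s (j - 1)}"
      using assms(1) s_range[of j] s_pred_neq[of j] by auto
    have "j - 1 \<in> {1..N}" using assms(1) by auto
    then show "h (s (j - 1)) i = 0" if "i \<in> {1..N} - {s (j - 1)}" "i \<noteq> s j" for i
      using that assms(2)[of "s (j - 1)" i] s_range[of "j - 1"] by simp
  qed simp
  finally show ?thesis .
qed

lemma sum_x: "j \<in> {1..N} \<Longrightarrow> (\<Sum>i=1..N. h i * x i j) = h (s j)"
  by (subst sum_column[of j]) (auto simp: x_def)

lemma sum_xx: "j \<in> {2..N} \<Longrightarrow>
  (\<Sum>i=1..N. \<Sum>i'\<in>{1..N} - {i}. h i i' * x i (j - 1) * x i' j) = h (s (j - 1)) (s j)"
  by (subst sum_arcs[of j]) (auto simp: x_def)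

lemma travel_time_eq: "travel_time p x \<xi> = (\<Sum>j=1..N. travel j \<xi>) + return_time \<xi>"
proof -
  obtain t d where \<xi>: "\<xi> = (t, d)" by fastforce
  obtain M where M: "N = M + 1" using customers_pos by (metis le_add_diff_inverse2)
  have "(\<Sum>j=2..N. \<Sum>i=1..N. \<Sum>i'\<in>{1..N} - {i}. t (i, i') * x i (j - 1) * x i' j) =
      (\<Sum>j=2..N. travel j \<xi>)"
  proof (rule sum.cong)
    fix j assume "j \<in> {2..N}"
    then show "(\<Sum>i=1..N. \<Sum>i'\<in>{1..N} - {i}. t (i, i') * x i (j - 1) * x i' j) = travel j \<xi>"
      using sum_xx[where h = "\<lambda>i i'. t (i, i')"] by (simp add: travel_def \<xi>)
  qed simp
  moreover have "(\<Sum>i=1..N. t (0, i) * x i 1 + t (i, 0) * x i N) = travel 1 \<xi> + return_time \<xi>"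
    using customers_pos sum_x[where h = "\<lambda>i. t (0, i)", of 1] sum_x[where h = "\<lambda>i. t (i, 0)", of N]
    by (simp add: sum.distrib travel_def return_time_def s_0 \<xi>)
  ultimately show ?thesis
    using sum_from_1[of "\<lambda>j. travel j \<xi>" M] by (simp add: travel_time_def \<xi> M del: sum.cl_ivl_Suc)
qed

text \<open>One formula for the right-hand sides of all recourse constraints. No service precedes
  position 1 and no travel leads to position \<open>N + 1\<close>; \<open>a 0 = 0\<close> brings the
  first constraint into the common form.\<close>

definition net :: "scenario \<Rightarrow> nat \<Rightarrow> real" where
  "net \<xi> j = (if j \<le> N then travel j \<xi> else 0) + (if 2 \<le> j then service j \<xi> else 0)
     - (a j - a (j - 1))"

lemma dual_value_net:
  "dual_value D \<xi> = (\<Sum>j=1..N + 1. dual D j * net \<xi> j) + travel_cost p * (\<Sum>j=1..N. travel j \<xi>)"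
proof -
  have "(\<Sum>j=1..N + 1. dual D j * (if j \<le> N then travel j \<xi> else 0)) =
      (\<Sum>j=1..N. dual D j * travel j \<xi>)"
    by simp
  moreover have "(\<Sum>j=1..N + 1. dual D j * (if 2 \<le> j then service j \<xi> else 0)) =
      (\<Sum>j=2..N + 1. dual D j * service j \<xi>)"
    by (subst sum_from_1) (simp del: sum.cl_ivl_Suc)
  ultimately show ?thesis
    by (simp add: dual_value_def net_def distrib_left right_diff_distrib distrib_right sum.distrib
        sum_subtractf sum_distrib_left del: sum.cl_ivl_Suc)
qed

text \<open>Feasibility says nothing about \<open>w 0\<close>. Overwriting it by 0 turns the three
  kinds of constraints into a single one.\<close>

lemma recourse_feasible_iff:
  "(w, u) \<in> recourse_feasible p x a \<xi> \<longleftrightarrow> (\<forall>j\<in>{1..N + 1}. 0 \<le> w j \<and> 0 \<le> u j) \<and>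
     (\<forall>j\<in>{1..N + 1}. (w(0 := 0)) j - (w(0 := 0)) (j - 1) - u j = net \<xi> j)"
proof -
  obtain t d where \<xi>: "\<xi> = (t, d)" by fastforce
  have a_0: "a 0 = 0" using schedule by (auto simp: schedules_def)
  have first: "(\<Sum>i=1..N. t (0, i) * x i 1) - a 1 = net \<xi> 1"
    using sum_x[where h = "\<lambda>i. t (0, i)", of 1] customers_pos
    by (simp add: net_def travel_def \<xi> s_0 a_0)
  have mid: "a (j - 1) - a j + (\<Sum>i=1..N. d i * x i (j - 1)) +
        (\<Sum>i=1..N. \<Sum>i'\<in>{1..N} - {i}. t (i, i') * x i (j - 1) * x i' j) = net \<xi> j"
    if "j \<in> {2..N}" for j
  proof -
    have "j - 1 \<in> {1..N}" using that by auto
    then show ?thesis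
      using sum_x[where h = d, of "j - 1"] sum_xx[where h = "\<lambda>i i'. t (i, i')", OF that] that
      by (simp add: net_def travel_def service_def \<xi>)
  qed
  have final: "a N - a (N + 1) + (\<Sum>i=1..N. d i * x i N) = net \<xi> (N + 1)"
    using sum_x[where h = d, of N] customers_pos by (simp add: net_def service_def \<xi>)
  have all_iff: "(\<forall>j\<in>{1..N + 1}. Q j) \<longleftrightarrow> Q 1 \<and> (\<forall>j\<in>{2..N}. Q j) \<and> Q (N + 1)" for Q
  proof -
    have "{1..N + 1} = insert 1 (insert (N + 1) {2..N})" using customers_pos by auto
    then show ?thesis by auto
  qed
  have "(w, u) \<in> recourse_feasible p x a \<xi> \<longleftrightarrow> (\<forall>j\<in>{1..N + 1}. 0 \<le> w j \<and> 0 \<le> u j) \<and>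
      (w 1 - u 1 = net \<xi> 1 \<and> (\<forall>j\<in>{2..N}. w j - w (j - 1) - u j = net \<xi> j) \<and>
       w (N + 1) - w N - u (N + 1) = net \<xi> (N + 1))"
    using first mid final by (simp add: recourse_feasible_def \<xi> Let_def)
  also have "\<dots> \<longleftrightarrow> (\<forall>j\<in>{1..N + 1}. 0 \<le> w j \<and> 0 \<le> u j) \<and>
     (\<forall>j\<in>{1..N + 1}. (w(0 := 0)) j - (w(0 := 0)) (j - 1) - u j = net \<xi> j)"
    unfolding all_iff[of "\<lambda>j. (w(0 := 0)) j - (w(0 := 0)) (j - 1) - u j = net \<xi> j"]
    using customers_pos by auto
  finally show ?thesis .
qed

text \<open>The greedy pair and its set of block ends have equal values. Weak duality therefore
  makes this value the minimum of the program and, at the same time, the maximum over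
  \<open>ends\<close>.\<close>

lemma recourse_eq:
  "recourse p x a \<xi> = Max ((\<lambda>D. dual_value D \<xi>) ` ends) + travel_cost p * return_time \<xi>"
proof -
  define cost where "cost = (\<lambda>(w, u). (\<Sum>j=1..N. wait_cost p j * w j + idle_cost p j * u j) +
     over_cost p * w (N + 1) + travel_cost p * travel_time p x \<xi>)"
  have cost: "cost (w, u) = (\<Sum>j=1..N + 1. cw p j * (w(0 := 0)) j + cu p j * u j) +
      travel_cost p * (\<Sum>j=1..N. travel j \<xi>) + travel_cost p * return_time \<xi>" for w u
    unfolding cost_def travel_time_eq by (simp add: cw_def cu_def distrib_left)
  have lower: "dual_value D \<xi> + travel_cost p * return_time \<xi> \<le> cost (w, u)"
    if "(w, u) \<in> recourse_feasible p x a \<xi>" for w u D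
  proof -
    have "(\<Sum>j=1..N + 1. dual D j * net \<xi> j) \<le>
        (\<Sum>j=1..N + 1. cw p j * (w(0 := 0)) j + cu p j * u j)"
      by (rule recourse_weak_duality) (use that[unfolded recourse_feasible_iff] in auto)
    then show ?thesis
      unfolding cost dual_value_net by (simp only: add_le_cancel_right)
  qed
  obtain w u D where wu: "w 0 = 0" "\<And>j. j \<in> {1..N + 1} \<Longrightarrow> 0 \<le> w j \<and> 0 \<le> u j"
    "\<And>j. j \<in> {1..N + 1} \<Longrightarrow> w j - w (j - 1) - u j = net \<xi> j" "D \<in> ends"
    "(\<Sum>j=1..N + 1. cw p j * w j + cu p j * u j) = (\<Sum>j=1..N + 1. dual D j * net \<xi> j)"
    by (rule recourse_strong_duality[where b = "net \<xi>"]) blast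
  have w0: "w(0 := 0) = w" using wu(1) by auto
  have feas: "(w, u) \<in> recourse_feasible p x a \<xi>"
    unfolding recourse_feasible_iff w0 using wu by auto
  have att: "cost (w, u) = dual_value D \<xi> + travel_cost p * return_time \<xi>"
    unfolding cost w0 dual_value_net wu(5) by simp
  have max: "Max ((\<lambda>D. dual_value D \<xi>) ` ends) = dual_value D \<xi>"
  proof (rule Max_eqI)
    fix y assume "y \<in> (\<lambda>D. dual_value D \<xi>) ` ends"
    then show "y \<le> dual_value D \<xi>" using lower[OF feas] att by auto
  qed (use wu(4) in auto)
  have "recourse p x a \<xi> = Inf (cost ` recourse_feasible p x a \<xi>)"
    by (simp add: recourse_def cost_def)
  also have "\<dots> = cost (w, u)"
  proof (rule cInf_eq_minimum)
    fix y assume "y \<in> cost ` recourse_feasible p x a \<xi>"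
    then show "cost (w, u) \<le> y" using lower att by auto
  qed (use feas in auto)
  finally show ?thesis using att max by simp
qed

lemma dual_slope:
  assumes "D \<in> ends" "j \<in> {2..N + 1}"
  shows "P1l p \<le> dual D j" "dual D j \<le> P1u p"
  using ppi_bounds[of j "next_end (N + 2) D j"] next_end_bounds[of j "N + 2" D] assms
  by (auto simp: dual_def)

text \<open>Only the arc into position 1 leaves the depot, which is why it alone has the bounds
  \<open>P2l\<close> and \<open>P2u\<close>. The lower bound subtracts \<open>travel_cost p\<close>
  although the slope adds it, so it leaves a margin of at least twice that cost.\<close>

lemma dual_slope_travel:
  assumes "j \<in> {1..N}"
  shows "alpha_lo p (s (j - 1)) (s j) \<le> dual D j + travel_cost p"
    "dual D j + travel_cost p \<le> alpha_hi p (s (j - 1)) (s j)"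
proof -
  have v: "j \<le> next_end (N + 2) D j" "next_end (N + 2) D j \<le> N + 2"
    using next_end_bounds[of j "N + 2" D] assms by auto
  have "s (j - 1) = 0 \<longleftrightarrow> j = 1"
    using s_eq_iff[of "j - 1" 0] s_0 assms by auto
  then show "alpha_lo p (s (j - 1)) (s j) \<le> dual D j + travel_cost p"
    "dual D j + travel_cost p \<le> alpha_hi p (s (j - 1)) (s j)"
    using ppi_bounds[of j "next_end (N + 2) D j"] ppi_1_bounds[of "next_end (N + 2) D 1"] v assms
      travel_cost_nonneg
    by (cases "j = 1"; auto simp: dual_def alpha_lo_def alpha_hi_def)+
qed

end

subsection \<open>Worst cases over the support box\<close>

text \<open>For \<open>l \<le> h\<close> this is the support function of the interval at
  \<open>c\<close>, written as in the epigraph constraints: the value at the lower end plus the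
  width times a positive part. The variables \<open>gamma\<close> and \<open>delta\<close> stand for
  these positive parts.\<close>

definition box_max :: "real \<Rightarrow> real \<Rightarrow> real \<Rightarrow> real" where
  "box_max l h c = l * c + (h - l) * max 0 c"

lemma box_max_ge:
  assumes "l \<le> t" "t \<le> h"
  shows "c * t \<le> box_max l h c"
proof (cases "c \<ge> 0")
  case True
  then show ?thesis using mult_left_mono[OF assms(2) True] by (simp add: box_max_def algebra_simps)
next
  case False
  then show ?thesis using mult_left_mono_neg[OF assms(1), of c] by (simp add: box_max_def algebra_simps)
qed

lemma box_max_attained: "c * (if c \<ge> 0 then h else l) = box_max l h c"
  by (simp add: box_max_def algebra_simps)

lemma box_max_mono: "l \<le> h \<Longrightarrow> g \<ge> 0 \<Longrightarrow> g \<ge> c \<Longrightarrow> box_max l h c \<le> l * c + (h - l) * g"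
  unfolding box_max_def by (intro add_left_mono mult_left_mono) auto

lemma mccormick_product:
  fixes b c lo hi :: real
  assumes "b \<in> {0, 1}" "lo \<le> c" "c \<le> hi"
  shows "lo * b \<le> c * b" "c * b \<le> hi * b" "c + hi * (b - 1) \<le> c * b" "c * b \<le> c + lo * (b - 1)"
  using assms by auto

context dhras_data begin

text \<open>Besides locating the mean, this shows that lower and upper ends of the box are ordered,
  which follows from the nonemptiness of the ambiguity set.\<close>

lemma mu_bounds:
  shows "(i, i') \<in> arcs p \<Longrightarrow> t_lo p i i' \<le> mu_t p i i' \<and> mu_t p i i' \<le> t_hi p i i'"
    and "k \<in> {1..N} \<Longrightarrow> d_lo p k \<le> mu_d p k \<and> mu_d p k \<le> d_hi p k"
proof -
  obtain P where P: "P \<in> ambiguity_set p" using ambiguity_nonempty by auto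
  then interpret prob_space P by (simp add: ambiguity_set_def)
  have "space P = space (restrict_space (scenario_space p) (support_set p))"
    using P by (intro sets_eq_imp_space_eq) (simp add: ambiguity_set_def)
  then have space: "\<xi> \<in> support_set p" if "\<xi> \<in> space P" for \<xi>
    using that by (auto simp: space_restrict_space)
  show "t_lo p i i' \<le> mu_t p i i' \<and> mu_t p i i' \<le> t_hi p i i'" if "(i, i') \<in> arcs p"
  proof -
    have i: "integrable P (\<lambda>(t, d). t (i, i'))" "(\<integral>(t, d). t (i, i') \<partial>P) = mu_t p i i'"
      using P that by (auto simp: ambiguity_set_def has_bochner_integral_iff)
    show ?thesis
      using integral_ge_const[OF i(1), of "t_lo p i i'"] integral_le_const[OF i(1), of "t_hi p i i'"] i(2)
        space that by (fastforce simp: support_set_def)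
  qed
  show "d_lo p k \<le> mu_d p k \<and> mu_d p k \<le> d_hi p k" if "k \<in> {1..N}"
  proof -
    have i: "integrable P (\<lambda>(t, d). d k)" "(\<integral>(t, d). d k \<partial>P) = mu_d p k"
      using P that by (auto simp: ambiguity_set_def has_bochner_integral_iff)
    show ?thesis
      using integral_ge_const[OF i(1), of "d_lo p k"] integral_le_const[OF i(1), of "d_hi p k"] i(2)
        space that by (fastforce simp: support_set_def)
  qed
qed

lemma P1_le: "P1l p \<le> P1u p"
  using ppi_bounds[of 2 2] customers_pos by simp

lemma P2_le: "P2l p \<le> P2u p"
  using ppi_1_bounds[of 1] by simp

text \<open>Points of the product spaces are extensional functions, hence the restrictions.\<close>

lemma restrict_in_support_set:
  assumes "\<And>i i'. (i, i') \<in> arcs p \<Longrightarrow> t_lo p i i' \<le> t (i, i') \<and> t (i, i') \<le> t_hi p i i'"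
    and "\<And>i. i \<in> {1..N} \<Longrightarrow> d_lo p i \<le> d i \<and> d i \<le> d_hi p i"
  shows "(restrict t (arcs p), restrict d {1..N}) \<in> support_set p"
  using assms order_trans[OF t_lo_nonneg] order_trans[OF d_lo_nonneg]
  by (auto simp: support_set_def scenario_space_def space_pair_measure space_PiM)

end

context dhras_decision begin

section \<open>Separating the maximum over the support box by positions\<close>

definition pos :: "nat \<Rightarrow> nat" where "pos = inv_into {..N} s"

lemma pos_s: "j \<le> N \<Longrightarrow> pos (s j) = j"
  unfolding pos_def by (rule inv_into_f_f) (auto simp: inj_on_def s_eq_iff)

lemma s_surj: "i \<le> N \<Longrightarrow> \<exists>j\<le>N. s j = i"
proof (cases "i = 0")
  case False
  moreover assume "i \<le> N"
  ultimately have "i \<in> s ` {1..N}" using s_bij by (auto simp: bij_betw_def)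
  then show ?thesis by auto
qed (use s_0 in auto)

lemma s_pos: "i \<le> N \<Longrightarrow> s (pos i) = i"
  using s_surj[of i] pos_s by auto

lemma pos_le: "i \<le> N \<Longrightarrow> pos i \<le> N"
  using s_surj[of i] pos_s by auto

text \<open>The edge weights of the longest path problem: with multipliers \<open>A\<close> for the
  arc into a position and \<open>R\<close> for the service before it, the maximum over the box
  splits into one term per position, which depends on \<open>D\<close> only through the end
  \<open>v\<close> of the block. Position \<open>N + 2\<close> weighs 0 but is a possible
  end.\<close>

definition node :: "(nat \<Rightarrow> real) \<Rightarrow> (nat \<Rightarrow> real) \<Rightarrow> nat \<Rightarrow> nat \<Rightarrow> real" where
  "node A R j v =
     (if j \<le> N then box_max (t_lo p (s (j - 1)) (s j)) (t_hi p (s (j - 1)) (s j))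
        (ppi p j v + travel_cost p - A j) else 0) +
     (if 2 \<le> j \<and> j \<le> N + 1 then box_max (d_lo p (s (j - 1))) (d_hi p (s (j - 1)))
        (ppi p j v - R j) else 0) +
     (if j \<le> N + 1 then (a (j - 1) - a j) * ppi p j v else 0)"

lemma sum_node:
  "(\<Sum>j=1..N + 2. node A R j (next_end (N + 2) D j)) =
     (\<Sum>j=1..N. box_max (t_lo p (s (j - 1)) (s j)) (t_hi p (s (j - 1)) (s j))
        (dual D j + travel_cost p - A j)) +
     (\<Sum>j=2..N + 1. box_max (d_lo p (s (j - 1))) (d_hi p (s (j - 1))) (dual D j - R j)) -
     (\<Sum>j=1..N + 1. dual D j * (a j - a (j - 1)))"
proof -
  have if_sum: "(\<Sum>j=1..N + 2. if Q j then h j else (0::real)) = (\<Sum>j=m..n. h j)"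
    if "\<And>j. (j \<in> {1..N + 2} \<and> Q j) = (j \<in> {m..n})" for Q h and m n :: nat
  proof -
    have "(\<Sum>j\<in>{1..N + 2}. if Q j then h j else (0::real)) = sum h ({1..N + 2} \<inter> {j. Q j})"
      unfolding sum.inter_restrict[OF finite_atLeastAtMost] by simp
    also have "{1..N + 2} \<inter> {j. Q j} = {m..n}" using that by blast
    finally show ?thesis .
  qed
  have "(\<Sum>j=1..N + 1. (a (j - 1) - a j) * dual D j) = - (\<Sum>j=1..N + 1. dual D j * (a j - a (j - 1)))"
    unfolding sum_negf[symmetric] by (rule sum.cong) (simp_all add: algebra_simps)
  then show ?thesis
    unfolding node_def dual_def[symmetric] sum.distrib
    by (subst if_sum[of "\<lambda>j. j \<le> N" 1 N], force, subst if_sum[of "\<lambda>j. 2 \<le> j \<and> j \<le> N + 1" 2 "N + 1"],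
        force, subst if_sum[of "\<lambda>j. j \<le> N + 1" 1 "N + 1"], force)
      (simp only: diff_conv_add_uminus)
qed

lemma dual_value_shift:
  "dual_value D \<xi> - (\<Sum>j=1..N. A j * travel j \<xi>) - (\<Sum>j=2..N + 1. R j * service j \<xi>) =
     (\<Sum>j=1..N. (dual D j + travel_cost p - A j) * travel j \<xi>) +
     (\<Sum>j=2..N + 1. (dual D j - R j) * service j \<xi>) - (\<Sum>j=1..N + 1. dual D j * (a j - a (j - 1)))"
  unfolding dual_value_def left_diff_distrib sum_subtractf by simp

lemma support_travel:
  assumes "\<xi> \<in> support_set p" "j \<in> {1..N}"
  shows "t_lo p (s (j - 1)) (s j) \<le> travel j \<xi>" "travel j \<xi> \<le> t_hi p (s (j - 1)) (s j)"
  using assms arc_in[of j] by (auto simp: support_set_def travel_def)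

lemma s_pred_range:
  assumes "j \<in> {2..N + 1}"
  shows "s (j - 1) \<in> {1..N}"
  by (rule s_range) (use assms in auto)

lemma support_service:
  assumes "\<xi> \<in> support_set p" "j \<in> {2..N + 1}"
  shows "d_lo p (s (j - 1)) \<le> service j \<xi>" "service j \<xi> \<le> d_hi p (s (j - 1))"
  using assms(1) s_pred_range[OF assms(2)] by (auto simp: support_set_def service_def)

lemma dual_value_le_node:
  assumes "\<xi> \<in> support_set p"
  shows "dual_value D \<xi> \<le> (\<Sum>j=1..N + 2. node A R j (next_end (N + 2) D j)) +
    (\<Sum>j=1..N. A j * travel j \<xi>) + (\<Sum>j=2..N + 1. R j * service j \<xi>)"
proof -
  have "(\<Sum>j=1..N. (dual D j + travel_cost p - A j) * travel j \<xi>) \<le>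
      (\<Sum>j=1..N. box_max (t_lo p (s (j - 1)) (s j)) (t_hi p (s (j - 1)) (s j))
        (dual D j + travel_cost p - A j))"
    by (intro sum_mono box_max_ge support_travel assms)
  moreover have "(\<Sum>j=2..N + 1. (dual D j - R j) * service j \<xi>) \<le>
      (\<Sum>j=2..N + 1. box_max (d_lo p (s (j - 1))) (d_hi p (s (j - 1))) (dual D j - R j))"
    by (intro sum_mono box_max_ge support_service assms)
  ultimately show ?thesis
    using dual_value_shift[of D \<xi> A R] unfolding sum_node by linarith
qed

text \<open>Every arc of the route and every customer occurs at exactly one position, so the
  coordinates of a maximising vertex can be chosen independently, each by the sign of its
  slope.\<close>

lemma node_attained:
  obtains \<xi> where "\<xi> \<in> support_set p"
    "(\<Sum>j=1..N + 2. node A R j (next_end (N + 2) D j)) =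
     dual_value D \<xi> - (\<Sum>j=1..N. A j * travel j \<xi>) - (\<Sum>j=2..N + 1. R j * service j \<xi>)"
proof -
  \<comment> \<open>The sign is looked up at the position of the head of the arc. This is right on
    the route; off the route either end of the interval is admissible and leaves the value
    unchanged.\<close>
  define t where "t = (\<lambda>(i, i'). if dual D (pos i') + travel_cost p - A (pos i') \<ge> 0
    then t_hi p i i' else t_lo p i i')"
  define d where "d i = (if dual D (pos i + 1) - R (pos i + 1) \<ge> 0 then d_hi p i else d_lo p i)" for i
  define \<xi> where "\<xi> = (restrict t (arcs p), restrict d {1..N})"
  show thesis
  proof (rule that)
    have tb: "t_lo p i i' \<le> t_hi p i i'" if "(i, i') \<in> arcs p" for i i'
      using mu_bounds(1)[OF that] by linarith
    have db: "d_lo p i \<le> d_hi p i" if "i \<in> {1..N}" for i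
      using mu_bounds(2)[OF that] by linarith
    show "\<xi> \<in> support_set p"
      unfolding \<xi>_def by (rule restrict_in_support_set) (use tb db in \<open>auto simp: t_def d_def\<close>)
    have tr: "(dual D j + travel_cost p - A j) * travel j \<xi> =
        box_max (t_lo p (s (j - 1)) (s j)) (t_hi p (s (j - 1)) (s j)) (dual D j + travel_cost p - A j)"
      if "j \<in> {1..N}" for j
    proof -
      have "travel j \<xi> = (if dual D j + travel_cost p - A j \<ge> 0
          then t_hi p (s (j - 1)) (s j) else t_lo p (s (j - 1)) (s j))"
        using arc_in[OF that] pos_s[of j] that by (simp add: travel_def \<xi>_def t_def)
      then show ?thesis by (simp only: box_max_attained)
    qed
    have sv: "(dual D j - R j) * service j \<xi> =
        box_max (d_lo p (s (j - 1))) (d_hi p (s (j - 1))) (dual D j - R j)"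
      if "j \<in> {2..N + 1}" for j
    proof -
      have "pos (s (j - 1)) + 1 = j" using pos_s[of "j - 1"] that by auto
      then have "service j \<xi> = (if dual D j - R j \<ge> 0 then d_hi p (s (j - 1)) else d_lo p (s (j - 1)))"
        using s_pred_range[OF that] by (simp add: service_def \<xi>_def d_def)
      then show ?thesis by (simp only: box_max_attained)
    qed
    show "(\<Sum>j=1..N + 2. node A R j (next_end (N + 2) D j)) =
      dual_value D \<xi> - (\<Sum>j=1..N. A j * travel j \<xi>) - (\<Sum>j=2..N + 1. R j * service j \<xi>)"
      unfolding dual_value_shift sum_node by (simp only: tr sv cong: sum.cong)
  qed
qed

section \<open>The epigraph constraints as inequalities over intervals of positions\<close>

definition block :: "milp_vars \<Rightarrow> nat \<Rightarrow> nat \<Rightarrow> real" where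
  "block z j v = (if j = 1 then - a 1 * ppi p 1 v + depot_block p x z v
     else if j \<le> N + 1 then (a (j - 1) - a j) * ppi p j v + travel_block p z j v + service_block p x z j v
     else 0)"

lemma sum_block:
  assumes "2 \<le> k" "k \<le> N + 1" "k \<le> Suc v" "v \<le> N + 2"
  shows "(\<Sum>j=k..v. block z j v) =
    (\<Sum>j=k..min v (N + 1). (a (j - 1) - a j) * ppi p j v) +
    (\<Sum>j=k..min v (N + 1). travel_block p z j v) + (\<Sum>j=k..min v (N + 1). service_block p x z j v)"
proof -
  have "(\<Sum>j=k..v. block z j v) = (\<Sum>j=k..min v (N + 1). block z j v)"
    by (rule sum.mono_neutral_right) (use assms in \<open>auto simp: block_def\<close>)
  also have "\<dots> = (\<Sum>j=k..min v (N + 1). (a (j - 1) - a j) * ppi p j v + travel_block p z j v +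
      service_block p x z j v)"
    by (rule sum.cong) (use assms in \<open>auto simp: block_def\<close>)
  finally show ?thesis by (simp add: sum.distrib)
qed

text \<open>The four families are the intervals with \<open>k = v = 1\<close>, with
  \<open>k = 1 < v\<close>, with \<open>k\<close> from 2 to \<open>N + 1\<close>, and with
  \<open>k = v = N + 2\<close>. The cut at \<open>min v (N + 1)\<close> disappears because
  \<open>block\<close> is zero at \<open>N + 2\<close>.\<close>

lemma epigraph_constraints_iff:
  "epigraph_constraints p x a z \<longleftrightarrow>
     (\<forall>k v. 1 \<le> k \<and> k \<le> v \<and> v \<le> N + 2 \<longrightarrow> (\<Sum>j=k..v. block z j v) \<le> (\<Sum>j=k..v. beta z j))"
  (is "_ \<longleftrightarrow> (\<forall>k v. ?range k v \<longrightarrow> ?ineq k v)")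
proof -
  have c1: "?ineq 1 1 \<longleftrightarrow> beta z 1 \<ge> - a 1 * ppi p 1 1 + depot_block p x z 1"
    by (simp add: block_def)
  have c2: "?ineq 1 v \<longleftrightarrow> (let m = min v (N + 1) in (\<Sum>j=1..v. beta z j) \<ge>
          - a 1 * ppi p 1 v + (\<Sum>j=2..m. (a (j - 1) - a j) * ppi p j v) +
          depot_block p x z v +
          (\<Sum>j=2..m. travel_block p z j v) +
          (\<Sum>j=2..m. service_block p x z j v))" if "v \<in> {2..N + 2}" for v
  proof -
    have "(\<Sum>j=1..v. block z j v) = block z 1 v + (\<Sum>j=2..v. block z j v)"
      using sum_from_1[of "\<lambda>j. block z j v" "v - 1"] that by (simp del: sum.cl_ivl_Suc)
    also have "(\<Sum>j=2..v. block z j v) = (\<Sum>j=2..min v (N + 1). (a (j - 1) - a j) * ppi p j v) +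
      (\<Sum>j=2..min v (N + 1). travel_block p z j v) + (\<Sum>j=2..min v (N + 1). service_block p x z j v)"
      using that customers_pos by (intro sum_block) auto
    also have "block z 1 v = - a 1 * ppi p 1 v + depot_block p x z v"
      by (simp add: block_def)
    finally show ?thesis unfolding Let_def by (simp only: ac_simps)
  qed
  have c3: "?ineq k v \<longleftrightarrow> (let m = min v (N + 1) in
        (\<Sum>j=k..v. beta z j) \<ge>
          (\<Sum>j=k..m. (a (j - 1) - a j) * ppi p j v) +
          (\<Sum>j=k..m. service_block p x z j v) +
          (\<Sum>j=k..m. travel_block p z j v))" if "k \<in> {2..N + 1}" "v \<in> {k..N + 2}" for k v
    unfolding Let_def by (subst sum_block) (use that in \<open>auto simp only: ac_simps atLeastAtMost_iff\<close>)
  have c4: "?ineq (N + 2) (N + 2) \<longleftrightarrow> beta z (N + 2) \<ge> 0"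
    by (simp add: block_def)
  have "(\<forall>k v. ?range k v \<longrightarrow> ?ineq k v) \<longleftrightarrow> ?ineq 1 1 \<and> (\<forall>v\<in>{2..N + 2}. ?ineq 1 v) \<and>
      (\<forall>k\<in>{2..N + 1}. \<forall>v\<in>{k..N + 2}. ?ineq k v) \<and> ?ineq (N + 2) (N + 2)" (is "?l \<longleftrightarrow> ?r")
  proof
    assume r: ?r
    show ?l
    proof (intro allI impI)
      fix k v assume kv: "?range k v"
      consider "k = 1" "v = 1" | "k = 1" "v \<in> {2..N + 2}" | "k \<in> {2..N + 1}" "v \<in> {k..N + 2}"
        | "k = N + 2" "v = N + 2" using kv by force
      then show "?ineq k v" using r by cases blast+
    qed
  next
    assume l: ?l
    show ?r by (intro conjI ballI; rule l[rule_format]) auto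
  qed
  then show ?thesis
    unfolding epigraph_constraints_def Let_def[of N]
    by (simp only: c1 c2 c3 c4 cong: ball_cong)
qed

subsection \<open>The mixed-integer program for a fixed decision\<close>

definition pos_objective :: "(nat \<Rightarrow> real) \<Rightarrow> (nat \<Rightarrow> real) \<Rightarrow> (nat \<Rightarrow> real) \<Rightarrow> real" where
  "pos_objective A R b = (\<Sum>j=1..N. A j * mu_t p (s (j - 1)) (s j)) +
     (\<Sum>j=2..N + 1. R j * mu_d p (s (j - 1))) + travel_cost p * mu_t p (s N) 0 + (\<Sum>j=1..N + 2. b j)"

lemma sum_reindex: "(\<Sum>i=1..N. h i) = (\<Sum>j=2..N + 1. h (s (j - 1)))" for h :: "nat \<Rightarrow> real"
proof -
  have "(\<Sum>i=1..N. h i) = (\<Sum>j=1..N. h (s j))"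
    using sum.reindex_bij_betw[OF s_bij, of h] by simp
  also have "\<dots> = (\<Sum>j=Suc 1..Suc N. h (s (j - 1)))"
    by (simp add: sum.shift_bounds_cl_Suc_ivl del: sum.cl_ivl_Suc)
  finally show ?thesis by (simp add: numeral_2_eq_2 del: sum.cl_ivl_Suc)
qed

lemma block_eq_node:
  assumes "j \<in> {1..N + 2}"
    and "j = 1 \<Longrightarrow> depot_block p x z v = box_max (t_lo p 0 (s 1)) (t_hi p 0 (s 1))
       (ppi p 1 v + travel_cost p - A 1)"
    and "j \<in> {2..N} \<Longrightarrow> travel_block p z j v = box_max (t_lo p (s (j - 1)) (s j)) (t_hi p (s (j - 1)) (s j))
       (ppi p j v + travel_cost p - A j)"
    and "j = N + 1 \<Longrightarrow> travel_block p z j v = 0"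
    and "j \<in> {2..N + 1} \<Longrightarrow> service_block p x z j v = box_max (d_lo p (s (j - 1))) (d_hi p (s (j - 1)))
       (ppi p j v - R j)"
  shows "block z j v = node A R j v"
proof -
  have a_0: "a 0 = 0" using schedule by (auto simp: schedules_def)
  consider "j = 1" | "j \<in> {2..N}" | "j = N + 1" "j \<noteq> 1" | "j = N + 2"
    using assms(1) by force
  then show ?thesis
    using assms(2-) customers_pos a_0 s_0 by cases (auto simp: block_def node_def)
qed

lemma node_le_block:
  assumes "j \<in> {1..N + 2}"
    and "j = 1 \<Longrightarrow> box_max (t_lo p 0 (s 1)) (t_hi p 0 (s 1)) (ppi p 1 v + travel_cost p - A 1)
       \<le> depot_block p x z v"
    and "j \<in> {2..N} \<Longrightarrow> box_max (t_lo p (s (j - 1)) (s j)) (t_hi p (s (j - 1)) (s j))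
       (ppi p j v + travel_cost p - A j) \<le> travel_block p z j v"
    and "j = N + 1 \<Longrightarrow> 0 \<le> travel_block p z j v"
    and "j \<in> {2..N + 1} \<Longrightarrow> box_max (d_lo p (s (j - 1))) (d_hi p (s (j - 1))) (ppi p j v - R j)
       \<le> service_block p x z j v"
  shows "node A R j v \<le> block z j v"
proof -
  have a_0: "a 0 = 0" using schedule by (auto simp: schedules_def)
  consider "j = 1" | "j \<in> {2..N}" | "j = N + 1" "j \<noteq> 1" | "j = N + 2"
    using assms(1) by force
  then show ?thesis
    using assms(2-) customers_pos a_0 s_0 by cases (auto simp: block_def node_def)
qed

text \<open>\<open>gamma\<close> and \<open>delta\<close> are bounded below by positive parts but
  may exceed them, so the blocks only dominate the node weights, which uses that the widths of the
  box are nonnegative. The objective contains neither of them and is determined exactly.\<close>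

lemma milp_lower:
  assumes feas: "(x, a, z) \<in> milp_feasible p"
  defines "A \<equiv> \<lambda>j. alpha z (s (j - 1)) (s j)" and "R \<equiv> \<lambda>j. rho z (s (j - 1))"
  shows "milp_objective p x z = pos_objective A R (beta z)"
    and "\<And>k v. 1 \<le> k \<Longrightarrow> k \<le> v \<Longrightarrow> v \<le> N + 2 \<Longrightarrow>
      (\<Sum>j=k..v. node A R j v) \<le> (\<Sum>j=k..v. beta z j)"
proof -
  have mc: "mccormick_constraints p x z" and pp: "positive_part_constraints p z"
    and ep: "epigraph_constraints p x a z"
    using feas by (auto simp: milp_feasible_def)
  note pp = pp[unfolded positive_part_constraints_def Let_def]
  note pp_depot = pp[THEN conjunct1, rule_format]
    and pp_arc = pp[THEN conjunct2, THEN conjunct1, rule_format]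
    and pp_service = pp[THEN conjunct2, THEN conjunct2, rule_format]
  note mc = mc[unfolded mccormick_constraints_def Let_def]
  note mc_eta = mc[THEN conjunct1, rule_format]
    and mc_psi = mc[THEN conjunct2, THEN conjunct1, rule_format]
    and mc_phi = mc[THEN conjunct2, THEN conjunct2, THEN conjunct1, rule_format]
    and mc_sigma = mc[THEN conjunct2, THEN conjunct2, THEN conjunct2, THEN conjunct1, rule_format]
    and mc_xi = mc[THEN conjunct2, THEN conjunct2, THEN conjunct2, THEN conjunct2, THEN conjunct1,
        rule_format]
    and mc_zeta = mc[THEN conjunct2, THEN conjunct2, THEN conjunct2, THEN conjunct2, THEN conjunct2,
        rule_format]
  have x1: "x (s j) j = 1" if "j \<in> {1..N}" for j using that by (simp add: x_def)
  have x0: "x i j = 0" if "i \<noteq> s j \<or> j \<notin> {1..N}" for i j using that by (auto simp: x_def)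
  have arc_off: "tau z i i' j = 0 \<and> eta z i i' j = 0 \<and> (\<forall>v\<in>{j..N + 2}. phi z i i' j v = 0)"
    if "i \<in> {1..N}" "i' \<in> {1..N} - {i}" "j \<in> {2..N + 1}" "x i (j - 1) = 0 \<or> x i' j = 0" for i i' j
  proof -
    have tau: "tau z i i' j = 0" using mc_eta[OF that(1-3)] that(4) by auto
    have "phi z i i' j v = 0" if "v \<in> {j..N + 2}" for v
      using mc_phi[OF \<open>i \<in> {1..N}\<close> \<open>i' \<in> {1..N} - {i}\<close> \<open>j \<in> {2..N + 1}\<close> that] tau by simp
    then show ?thesis using mc_eta[OF that(1-3)] tau by simp
  qed
  have arc_on: "tau z (s (j - 1)) (s j) j = 1 \<and> eta z (s (j - 1)) (s j) j = A j \<and>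
      (\<forall>v\<in>{j..N + 2}. 0 \<le> phi z (s (j - 1)) (s j) j v \<and>
        ppi p j v + travel_cost p - A j \<le> phi z (s (j - 1)) (s j) j v)"
    if j: "j \<in> {2..N}" for j
  proof -
    have r: "s (j - 1) \<in> {1..N}" "s j \<in> {1..N} - {s (j - 1)}" "j \<in> {2..N + 1}"
      using s_pred_range[of j] s_range[of j] s_pred_neq[of j] j by auto
    have "j - 1 \<in> {1..N}" "j \<in> {1..N}" using j by auto
    then have xs: "x (s (j - 1)) (j - 1) = 1" "x (s j) j = 1" by (simp_all only: x1)
    have tau: "tau z (s (j - 1)) (s j) j = 1" using mc_eta[OF r] xs by simp
    have "eta z (s (j - 1)) (s j) j = A j" using mc_eta[OF r] tau by (simp add: A_def)
    moreover have "0 \<le> phi z (s (j - 1)) (s j) j v \<and>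
        ppi p j v + travel_cost p - A j \<le> phi z (s (j - 1)) (s j) j v" if "v \<in> {j..N + 2}" for v
    proof -
      have "gamma z (s (j - 1)) (s j) j v \<le> phi z (s (j - 1)) (s j) j v"
        "0 \<le> phi z (s (j - 1)) (s j) j v"
        using mc_phi[OF r that] tau by simp_all
      moreover have "ppi p j v + travel_cost p - A j \<le> gamma z (s (j - 1)) (s j) j v"
        using pp_arc[OF r that] unfolding A_def by blast
      ultimately show ?thesis by linarith
    qed
    ultimately show ?thesis using tau by blast
  qed
  have depot_off: "psi z i = 0 \<and> (\<forall>v\<in>{1..N + 2}. sigma z i v = 0)"
    if "i \<in> {1..N}" "i \<noteq> s 1" for i
    using mc_psi[OF that(1)] mc_sigma[OF that(1)] that x0[of i 1] by fastforce
  have one: "1 \<in> {1..N}" using customers_pos by simp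
  have depot_on: "psi z (s 1) = A 1 \<and> (\<forall>v\<in>{1..N + 2}. 0 \<le> sigma z (s 1) v \<and>
      ppi p 1 v + travel_cost p - A 1 \<le> sigma z (s 1) v)"
  proof -
    have r: "s 1 \<in> {1..N}" using s_range[OF one] .
    have "psi z (s 1) = A 1" using mc_psi[OF r] x1[OF one] by (simp add: A_def s_0)
    moreover have "0 \<le> sigma z (s 1) v \<and> ppi p 1 v + travel_cost p - A 1 \<le> sigma z (s 1) v"
      if "v \<in> {1..N + 2}" for v
    proof -
      have "gamma z 0 (s 1) 1 v \<le> sigma z (s 1) v" "0 \<le> sigma z (s 1) v"
        using mc_sigma[OF r that] x1[OF one] by simp_all
      moreover have "ppi p 1 v + travel_cost p - A 1 \<le> gamma z 0 (s 1) 1 v"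
        using pp_depot[OF r that] by (simp add: A_def s_0)
      ultimately show ?thesis by linarith
    qed
    ultimately show ?thesis by blast
  qed
  have service_off: "zeta z i j = 0 \<and> (\<forall>v\<in>{j..N + 2}. xi z i j v = 0)"
    if "i \<in> {1..N}" "j \<in> {2..N + 1}" "i \<noteq> s (j - 1)" for i j
  proof -
    have "x i (j - 1) = 0" using x0 that by auto
    then show ?thesis using mc_zeta[OF that(1,2)] mc_xi[OF that(1,2)] by fastforce
  qed
  have service_on: "zeta z (s (j - 1)) j = R j \<and> (\<forall>v\<in>{j..N + 2}. 0 \<le> xi z (s (j - 1)) j v \<and>
      ppi p j v - R j \<le> xi z (s (j - 1)) j v)" if j: "j \<in> {2..N + 1}" for j
  proof -
    have r: "s (j - 1) \<in> {1..N}" using s_pred_range[OF j] .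
    have x: "x (s (j - 1)) (j - 1) = 1" by (rule x1) (use j in auto)
    have "zeta z (s (j - 1)) j = R j" using mc_zeta[OF r j] x by (simp add: R_def)
    moreover have "0 \<le> xi z (s (j - 1)) j v \<and> ppi p j v - R j \<le> xi z (s (j - 1)) j v"
      if "v \<in> {j..N + 2}" for v
    proof -
      have "delta z (s (j - 1)) j v \<le> xi z (s (j - 1)) j v" "0 \<le> xi z (s (j - 1)) j v"
        using mc_xi[OF r j that] x by simp_all
      moreover have "ppi p j v - R j \<le> delta z (s (j - 1)) j v"
        using pp_service[OF r j that] unfolding R_def by blast
      ultimately show ?thesis by linarith
    qed
    ultimately show ?thesis by blast
  qed
  have tb: "t_lo p i i' \<le> t_hi p i i'" if "(i, i') \<in> arcs p" for i i'
    using mu_bounds(1)[OF that] by linarith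
  have db: "d_lo p i \<le> d_hi p i" if "i \<in> {1..N}" for i
    using mu_bounds(2)[OF that] by linarith
  have node_block: "node A R j v \<le> block z j v" if j: "j \<in> {1..N + 2}" and v: "v \<in> {j..N + 2}" for j v
  proof (rule node_le_block[OF j])
    assume "j = 1"
    then have v1: "v \<in> {1..N + 2}" using v by simp
    have "depot_block p x z v = t_lo p 0 (s 1) * (ppi p 1 v + travel_cost p - A 1) +
        (t_hi p 0 (s 1) - t_lo p 0 (s 1)) * sigma z (s 1) v"
      unfolding depot_block_def
      by (subst sum_column[OF one]) (use depot_off depot_on v1 x0[of _ 1] x1[OF one] in auto)
    then show "box_max (t_lo p 0 (s 1)) (t_hi p 0 (s 1)) (ppi p 1 v + travel_cost p - A 1)
       \<le> depot_block p x z v"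
      using box_max_mono[OF tb[OF arc_in[OF one]]] depot_on v1 by (simp add: s_0)
  next
    assume j: "j \<in> {2..N}"
    have "travel_block p z j v = t_lo p (s (j - 1)) (s j) * (ppi p j v + travel_cost p - A j) +
        (t_hi p (s (j - 1)) (s j) - t_lo p (s (j - 1)) (s j)) * phi z (s (j - 1)) (s j) j v"
      unfolding travel_block_def
    proof (subst sum_arcs[OF j])
      fix i i' assume i: "i \<in> {1..N}" "i' \<in> {1..N}" "i \<noteq> i'" "i \<noteq> s (j - 1) \<or> i' \<noteq> s j"
      then have "x i (j - 1) = 0 \<or> x i' j = 0" using x0 by auto
      then have "tau z i i' j = 0" "eta z i i' j = 0" "phi z i i' j v = 0"
        using arc_off[of i i' j] i j v by auto
      then show "t_lo p i i' * (ppi p j v * tau z i i' j + travel_cost p * tau z i i' j - eta z i i' j) +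
          (t_hi p i i' - t_lo p i i') * phi z i i' j v = 0" by simp
    qed (use arc_on[OF j] in auto)
    then show "box_max (t_lo p (s (j - 1)) (s j)) (t_hi p (s (j - 1)) (s j))
       (ppi p j v + travel_cost p - A j) \<le> travel_block p z j v"
      using box_max_mono[OF tb[OF arc_in[of j]]] arc_on[OF j] v j by simp
  next
    \<comment> \<open>Column \<open>N + 1\<close> of \<open>x\<close> is zero, which forces
      \<open>tau\<close>, and with it \<open>eta\<close> and \<open>phi\<close>, to vanish.\<close>
    assume j: "j = N + 1"
    have "tau z i i' j = 0 \<and> eta z i i' j = 0 \<and> phi z i i' j v = 0"
      if "i \<in> {1..N}" "i' \<in> {1..N} - {i}" for i i'
      using arc_off[OF that, of j] x0[of i' j] customers_pos v j by simp
    then show "0 \<le> travel_block p z j v"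
      unfolding travel_block_def by (intro sum_nonneg) simp
  next
    assume j: "j \<in> {2..N + 1}"
    have j1: "j - 1 \<in> {1..N}" using j by auto
    have "service_block p x z j v = d_lo p (s (j - 1)) * (ppi p j v - R j) +
        (d_hi p (s (j - 1)) - d_lo p (s (j - 1))) * xi z (s (j - 1)) j v"
      unfolding service_block_def
      by (subst sum_column[OF j1])
        (use service_off[OF _ j] service_on[OF j] v x0[of _ "j - 1"] x1[OF j1] in auto)
    then show "box_max (d_lo p (s (j - 1))) (d_hi p (s (j - 1))) (ppi p j v - R j)
       \<le> service_block p x z j v"
      using box_max_mono[OF db[OF s_pred_range[OF j]]] service_on[OF j] v by simp
  qed
  show "(\<Sum>j=k..v. node A R j v) \<le> (\<Sum>j=k..v. beta z j)" if "1 \<le> k" "k \<le> v" "v \<le> N + 2" for k v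
  proof -
    have "(\<Sum>j=k..v. node A R j v) \<le> (\<Sum>j=k..v. block z j v)"
      by (rule sum_mono, rule node_block) (use that in auto)
    also have "\<dots> \<le> (\<Sum>j=k..v. beta z j)"
      using ep that unfolding epigraph_constraints_iff by blast
    finally show ?thesis .
  qed
  have "(\<Sum>j=2..N. \<Sum>i=1..N. \<Sum>i'\<in>{1..N} - {i}. mu_t p i i' * eta z i i' j) =
      (\<Sum>j=2..N. A j * mu_t p (s (j - 1)) (s j))"
  proof (rule sum.cong)
    fix j assume j: "j \<in> {2..N}"
    show "(\<Sum>i=1..N. \<Sum>i'\<in>{1..N} - {i}. mu_t p i i' * eta z i i' j) = A j * mu_t p (s (j - 1)) (s j)"
    proof (subst sum_arcs[OF j])
      fix i i' assume i: "i \<in> {1..N}" "i' \<in> {1..N}" "i \<noteq> i'" "i \<noteq> s (j - 1) \<or> i' \<noteq> s j"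
      then have "x i (j - 1) = 0 \<or> x i' j = 0" using x0 by auto
      then show "mu_t p i i' * eta z i i' j = 0" using arc_off[of i i' j] i j by auto
    qed (use arc_on[OF j] in auto)
  qed simp
  moreover have "(\<Sum>i=1..N. mu_t p 0 i * psi z i) = A 1 * mu_t p 0 (s 1)"
    by (subst sum_column[OF one]) (use depot_off depot_on in auto)
  moreover have "(\<Sum>i=1..N. mu_t p i 0 * x i N) = mu_t p (s N) 0"
    using customers_pos by (intro sum_x) simp
  moreover have "(\<Sum>i=1..N. mu_d p i * rho z i) = (\<Sum>j=2..N + 1. R j * mu_d p (s (j - 1)))"
    unfolding sum_reindex R_def by (simp add: mult.commute del: sum.cl_ivl_Suc)
  moreover have "(\<Sum>j=1..N. A j * mu_t p (s (j - 1)) (s j)) =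
      A 1 * mu_t p 0 (s 1) + (\<Sum>j=2..N. A j * mu_t p (s (j - 1)) (s j))"
    using sum_from_1[of "\<lambda>j. A j * mu_t p (s (j - 1)) (s j)" "N - 1"] customers_pos
    by (simp add: s_0 del: sum.cl_ivl_Suc)
  ultimately show "milp_objective p x z = pos_objective A R (beta z)"
    unfolding milp_objective_def pos_objective_def Let_def by simp
qed

text \<open>The bounds on \<open>A\<close> and \<open>R\<close> are exactly what the McCormick
  inequalities demand of the multipliers. With the positive parts taken as small as possible, the
  blocks equal the node weights, so \<open>b\<close> can serve as \<open>beta\<close>.\<close>

lemma milp_upper:
  assumes A: "\<And>j. j \<in> {1..N} \<Longrightarrow> alpha_lo p (s (j - 1)) (s j) \<le> A j \<and> A j \<le> alpha_hi p (s (j - 1)) (s j)"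
    and R: "\<And>j. j \<in> {2..N + 1} \<Longrightarrow> P1l p \<le> R j \<and> R j \<le> P1u p"
    and b: "\<And>k v. 1 \<le> k \<Longrightarrow> k \<le> v \<Longrightarrow> v \<le> N + 2 \<Longrightarrow>
      (\<Sum>j=k..v. node A R j v) \<le> (\<Sum>j=k..v. b j)"
    and x: "x \<in> assignments p"
  shows "\<exists>z. (x, a, z) \<in> milp_feasible p \<and> milp_objective p x z = pos_objective A R b"
proof -
  \<comment> \<open>\<open>A\<close> is indexed by positions, \<open>alpha\<close> by arcs. Arcs off
    the route have \<open>tau = 0\<close>, so any value within their bounds would fit.\<close>
  define al where "al i i' = (if pos i + 1 \<le> N \<and> s (pos i + 1) = i' then A (pos i + 1)
    else alpha_lo p i i')" for i i'
  define ga where "ga i i' j v = max 0 (ppi p j v + travel_cost p - al i i')" for i i' j v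
  define de where "de i j v = max 0 (ppi p j v - R (pos i + 1))" for i j v
  define z where "z = \<lparr>alpha = al, rho = (\<lambda>i. R (pos i + 1)), beta = b, gamma = ga, delta = de,
    tau = (\<lambda>i i' j. x i (j - 1) * x i' j), eta = (\<lambda>i i' j. al i i' * (x i (j - 1) * x i' j)),
    psi = (\<lambda>i. al 0 i * x i 1), phi = (\<lambda>i i' j v. ga i i' j v * (x i (j - 1) * x i' j)),
    sigma = (\<lambda>i v. ga 0 i 1 v * x i 1), xi = (\<lambda>i j v. de i j v * x i (j - 1)),
    zeta = (\<lambda>i j. R (pos i + 1) * x i (j - 1))\<rparr>"
  have z: "alpha z = al" "rho z = (\<lambda>i. R (pos i + 1))" "beta z = b" "gamma z = ga" "delta z = de"
    "tau z i i' j = x i (j - 1) * x i' j" "eta z i i' j = al i i' * (x i (j - 1) * x i' j)"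
    "psi z i = al 0 i * x i 1" "phi z i i' j v = ga i i' j v * (x i (j - 1) * x i' j)"
    "sigma z i v = ga 0 i 1 v * x i 1" "xi z i j v = de i j v * x i (j - 1)"
    "zeta z i j = R (pos i + 1) * x i (j - 1)" for i i' j v
    by (simp_all add: z_def)
  have bin: "x i j \<in> {0, 1}" "x i (j - 1) * x i' j \<in> {0, 1}" for i i' j by (auto simp: x_def)
  have alpha_le: "alpha_lo p i i' \<le> alpha_hi p i i'" for i i'
    using P1_le P2_le travel_cost_nonneg by (simp add: alpha_lo_def alpha_hi_def)
  have al: "alpha_lo p i i' \<le> al i i'" "al i i' \<le> alpha_hi p i i'" if "i \<le> N" for i i'
    using A[of "pos i + 1"] s_pos[OF that] alpha_le[of i i'] by (auto simp: al_def)
  have R': "P1l p \<le> R (pos i + 1)" "R (pos i + 1) \<le> P1u p" if "i \<in> {1..N}" for i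
  proof -
    have "pos i \<noteq> 0" using s_pos[of i] s_0 that by (metis atLeastAtMost_iff not_one_le_zero)
    then have "pos i + 1 \<in> {2..N + 1}" using pos_le[of i] that by auto
    then show "P1l p \<le> R (pos i + 1)" "R (pos i + 1) \<le> P1u p" using R by blast+
  qed
  \<comment> \<open>\<open>gamma_hi\<close> is the value of
    \<open>ppi p j v + travel_cost p - alpha\<close> at the smallest admissible
    \<open>alpha\<close>, and it is nonnegative since \<open>ppi\<close> is at least
    \<open>P1l p\<close>.\<close>
  have ga_le: "ga i i' j v \<le> gamma_hi p i i' j v"
    if "i \<in> {1..N}" "j \<in> {2..N + 1}" "v \<in> {j..N + 2}" for i i' j v
    using al(1)[of i i'] ppi_bounds[OF that(2,3)] travel_cost_nonneg that(1)
    by (simp add: ga_def gamma_hi_def alpha_lo_def)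
  have ga_1_le: "ga 0 i 1 v \<le> gamma_hi p 0 i 1 v" if "v \<in> {1..N + 2}" for i v
    using al(1)[of 0 i] ppi_1_bounds[OF that] travel_cost_nonneg
    by (simp add: ga_def gamma_hi_def alpha_lo_def)
  have de_le: "de i j v \<le> delta_hi p i j v"
    if "i \<in> {1..N}" "j \<in> {2..N + 1}" "v \<in> {j..N + 2}" for i j v
    using R'(1)[OF that(1)] ppi_bounds[OF that(2,3)] by (simp add: de_def delta_hi_def)
  have ga_0: "0 \<le> ga i i' j v" and de_0: "0 \<le> de i j v" for i i' j v
    by (simp_all add: ga_def de_def)
  have mc: "mccormick_constraints p x z"
    unfolding mccormick_constraints_def Let_def z
  proof (intro conjI ballI)
    fix i i' j assume i: "i \<in> {1..N}" "i' \<in> {1..N} - {i}" "j \<in> {2..N + 1}"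
    have iN: "i \<le> N" using i by simp
    show "x i (j - 1) + x i' j - 1 \<le> x i (j - 1) * x i' j" "0 \<le> x i (j - 1) * x i' j"
      "x i (j - 1) * x i' j \<le> x i (j - 1)" "x i (j - 1) * x i' j \<le> x i' j"
      using bin(1)[of i "j - 1"] bin(1)[of i' j] by auto
    show "alpha_lo p i i' * (x i (j - 1) * x i' j) \<le> al i i' * (x i (j - 1) * x i' j)"
      "al i i' * (x i (j - 1) * x i' j) \<le> alpha_hi p i i' * (x i (j - 1) * x i' j)"
      "al i i' + alpha_hi p i i' * (x i (j - 1) * x i' j - 1) \<le> al i i' * (x i (j - 1) * x i' j)"
      "al i i' * (x i (j - 1) * x i' j) \<le> al i i' + alpha_lo p i i' * (x i (j - 1) * x i' j - 1)"
      by (rule mccormick_product[OF bin(2) al[OF iN]])+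
    fix v assume v: "v \<in> {j..N + 2}"
    show "ga i i' j v + gamma_hi p i i' j v * (x i (j - 1) * x i' j - 1) \<le> ga i i' j v * (x i (j - 1) * x i' j)"
      "0 \<le> ga i i' j v * (x i (j - 1) * x i' j)"
      "ga i i' j v * (x i (j - 1) * x i' j) \<le> gamma_hi p i i' j v * (x i (j - 1) * x i' j)"
      "ga i i' j v * (x i (j - 1) * x i' j) \<le> ga i i' j v"
      using mccormick_product[OF bin(2)[of i j i'] ga_0[of i i' j v] ga_le[OF i(1,3) v, of i']]
      by simp_all
  next
    fix i assume i: "i \<in> {1..N}"
    show "alpha_lo p 0 i * x i 1 \<le> al 0 i * x i 1" "al 0 i * x i 1 \<le> alpha_hi p 0 i * x i 1"
      "al 0 i + alpha_hi p 0 i * (x i 1 - 1) \<le> al 0 i * x i 1"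
      "al 0 i * x i 1 \<le> al 0 i + alpha_lo p 0 i * (x i 1 - 1)"
      by (rule mccormick_product[OF bin(1) al]; simp)+
    fix v assume v: "v \<in> {1..N + 2}"
    show "ga 0 i 1 v + gamma_hi p 0 i 1 v * (x i 1 - 1) \<le> ga 0 i 1 v * x i 1"
      "0 \<le> ga 0 i 1 v * x i 1" "ga 0 i 1 v * x i 1 \<le> gamma_hi p 0 i 1 v * x i 1"
      "ga 0 i 1 v * x i 1 \<le> ga 0 i 1 v"
      using mccormick_product[OF bin(1)[of i 1] ga_0[of 0 i 1 v] ga_1_le[OF v, of i]] by simp_all
  next
    fix i j assume i: "i \<in> {1..N}" and j: "j \<in> {2..N + 1}"
    show "rho_lo p i * x i (j - 1) \<le> R (pos i + 1) * x i (j - 1)"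
      "R (pos i + 1) * x i (j - 1) \<le> rho_hi p i * x i (j - 1)"
      "R (pos i + 1) + rho_hi p i * (x i (j - 1) - 1) \<le> R (pos i + 1) * x i (j - 1)"
      "R (pos i + 1) * x i (j - 1) \<le> R (pos i + 1) + rho_lo p i * (x i (j - 1) - 1)"
      unfolding rho_lo_def rho_hi_def by (rule mccormick_product[OF bin(1) R'[OF i]])+
    fix v assume v: "v \<in> {j..N + 2}"
    show "de i j v + delta_hi p i j v * (x i (j - 1) - 1) \<le> de i j v * x i (j - 1)"
      "0 \<le> de i j v * x i (j - 1)" "de i j v * x i (j - 1) \<le> de i j v"
      "de i j v * x i (j - 1) \<le> delta_hi p i j v * x i (j - 1)"
      using mccormick_product[OF bin(1)[of i "j - 1"] de_0[of i j v] de_le[OF i j v]] by simp_all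
  qed
  have pp: "positive_part_constraints p z"
    unfolding positive_part_constraints_def Let_def z by (auto simp: ga_def de_def)
  have al_pos: "al (s (j - 1)) (s j) = A j" if "j \<in> {1..N}" for j
  proof -
    have "pos (s (j - 1)) + 1 = j" using pos_s[of "j - 1"] that by auto
    then show ?thesis using that by (simp add: al_def)
  qed
  have R_pos: "R (pos (s (j - 1)) + 1) = R j" if "j \<in> {2..N + 1}" for j
  proof -
    have "pos (s (j - 1)) + 1 = j" using pos_s[of "j - 1"] that by auto
    then show ?thesis by simp
  qed
  have one: "1 \<in> {1..N}" using customers_pos by simp
  have node: "block z j v = node A R j v" if j: "j \<in> {1..N + 2}" for j v
  proof (rule block_eq_node[OF j])
    have "al 0 (s 1) = A 1" using al_pos[OF one] by (simp add: s_0)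
    moreover have "depot_block p x z v = t_lo p 0 (s 1) * (ppi p 1 v + travel_cost p - al 0 (s 1)) +
        (t_hi p 0 (s 1) - t_lo p 0 (s 1)) * ga 0 (s 1) 1 v"
      unfolding depot_block_def z by (subst sum_column[OF one]) (use one in \<open>auto simp: x_def\<close>)
    ultimately show "depot_block p x z v = box_max (t_lo p 0 (s 1)) (t_hi p 0 (s 1))
       (ppi p 1 v + travel_cost p - A 1)"
      by (simp add: ga_def box_max_def)
  next
    assume j: "j \<in> {2..N}"
    have xs: "x (s (j - 1)) (j - 1) = 1" "x (s j) j = 1" using j by (auto simp: x_def)
    have "travel_block p z j v =
        t_lo p (s (j - 1)) (s j) * (ppi p j v + travel_cost p - al (s (j - 1)) (s j)) +
        (t_hi p (s (j - 1)) (s j) - t_lo p (s (j - 1)) (s j)) * ga (s (j - 1)) (s j) j v"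
      unfolding travel_block_def z by (subst sum_arcs[OF j]) (use xs in \<open>auto simp: x_def\<close>)
    then show "travel_block p z j v = box_max (t_lo p (s (j - 1)) (s j)) (t_hi p (s (j - 1)) (s j))
       (ppi p j v + travel_cost p - A j)"
      using al_pos[of j] j by (simp add: ga_def box_max_def)
  next
    assume "j = N + 1"
    then have "x i j = 0" for i by (simp add: x_def)
    then show "travel_block p z j v = 0" by (simp add: travel_block_def z)
  next
    assume j: "j \<in> {2..N + 1}"
    have j1: "j - 1 \<in> {1..N}" using j by auto
    have "service_block p x z j v = d_lo p (s (j - 1)) * (ppi p j v - R (pos (s (j - 1)) + 1)) +
        (d_hi p (s (j - 1)) - d_lo p (s (j - 1))) * de (s (j - 1)) j v"
      unfolding service_block_def z by (subst sum_column[OF j1]) (use j1 in \<open>auto simp: x_def\<close>)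
    then show "service_block p x z j v = box_max (d_lo p (s (j - 1))) (d_hi p (s (j - 1)))
       (ppi p j v - R j)"
      unfolding de_def R_pos[OF j] box_max_def .
  qed
  have ep: "epigraph_constraints p x a z"
    unfolding epigraph_constraints_iff
  proof (intro allI impI)
    fix k v assume kv: "1 \<le> k \<and> k \<le> v \<and> v \<le> N + 2"
    have "(\<Sum>j=k..v. block z j v) = (\<Sum>j=k..v. node A R j v)"
      by (rule sum.cong) (use kv in \<open>auto intro!: node\<close>)
    then show "(\<Sum>j=k..v. block z j v) \<le> (\<Sum>j=k..v. beta z j)" using b kv z(3) by simp
  qed
  have feas: "(x, a, z) \<in> milp_feasible p"
    using mc pp ep x schedule by (simp add: milp_feasible_def)
  moreover have "milp_objective p x z = pos_objective A R b"
  proof -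
    have "(\<Sum>j=1..N. alpha z (s (j - 1)) (s j) * mu_t p (s (j - 1)) (s j)) =
        (\<Sum>j=1..N. A j * mu_t p (s (j - 1)) (s j))"
      by (rule sum.cong) (simp_all only: z al_pos)
    moreover have "(\<Sum>j=2..N + 1. rho z (s (j - 1)) * mu_d p (s (j - 1))) =
        (\<Sum>j=2..N + 1. R j * mu_d p (s (j - 1)))"
      by (rule sum.cong) (simp_all only: z R_pos)
    ultimately show ?thesis
      unfolding milp_lower(1)[OF feas] pos_objective_def z(3) by (simp only:)
  qed
  ultimately show ?thesis by blast
qed

subsection \<open>The moment problem\<close>

definition core :: "scenario \<Rightarrow> real" where
  "core \<xi> = Max ((\<lambda>D. dual_value D \<xi>) ` ends)"

lemma recourse_core: "recourse p x a \<xi> = core \<xi> + travel_cost p * return_time \<xi>"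
  by (simp add: recourse_eq core_def)

lemma dual_value_le_core: "D \<in> ends \<Longrightarrow> dual_value D \<xi> \<le> core \<xi>"
  unfolding core_def by (rule Max_ge) auto

lemma core_attained: obtains D where "D \<in> ends" "core \<xi> = dual_value D \<xi>"
proof -
  have "core \<xi> \<in> (\<lambda>D. dual_value D \<xi>) ` ends" unfolding core_def by (rule Max_in) auto
  then show thesis using that by auto
qed

lemma ambiguity_space: "P \<in> ambiguity_set p \<Longrightarrow> space P = support_set p"
proof -
  assume "P \<in> ambiguity_set p"
  then have "space P = space (restrict_space (scenario_space p) (support_set p))"
    by (intro sets_eq_imp_space_eq) (simp add: ambiguity_set_def)
  then show ?thesis by (auto simp: space_restrict_space support_set_def)
qed

lemma ambiguity_integrals:
  assumes P: "P \<in> ambiguity_set p"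
  shows "j \<in> {1..N} \<Longrightarrow> has_bochner_integral P (travel j) (mu_t p (s (j - 1)) (s j))"
    and "j \<in> {2..N + 1} \<Longrightarrow> has_bochner_integral P (service j) (mu_d p (s (j - 1)))"
    and "has_bochner_integral P return_time (mu_t p (s N) 0)"
proof -
  have t: "has_bochner_integral P (\<lambda>\<xi>. fst \<xi> (i, i')) (mu_t p i i')" if "(i, i') \<in> arcs p" for i i'
    using P that by (fastforce simp: ambiguity_set_def case_prod_unfold)
  have d: "has_bochner_integral P (\<lambda>\<xi>. snd \<xi> i) (mu_d p i)" if "i \<in> {1..N}" for i
    using P that by (simp add: ambiguity_set_def case_prod_unfold)
  show "j \<in> {1..N} \<Longrightarrow> has_bochner_integral P (travel j) (mu_t p (s (j - 1)) (s j))"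
    using t[OF arc_in] by (simp add: travel_def[abs_def])
  show "j \<in> {2..N + 1} \<Longrightarrow> has_bochner_integral P (service j) (mu_d p (s (j - 1)))"
    using d[OF s_pred_range] by (simp add: service_def[abs_def])
  show "has_bochner_integral P return_time (mu_t p (s N) 0)"
    using t[OF return_arc_in] by (simp add: return_time_def[abs_def])
qed

text \<open>Weak duality for the moment problem: an affine majorant is integrated, and only its
  value at the mean remains.\<close>

lemma recourse_expectation_le:
  assumes P: "P \<in> ambiguity_set p"
    and le: "\<And>\<xi>. \<xi> \<in> support_set p \<Longrightarrow>
      core \<xi> \<le> W + (\<Sum>j=1..N. A j * travel j \<xi>) + (\<Sum>j=2..N + 1. R j * service j \<xi>)"
  shows "(\<integral>\<xi>. recourse p x a \<xi> \<partial>P) \<le> W + (\<Sum>j=1..N. A j * mu_t p (s (j - 1)) (s j)) +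
      (\<Sum>j=2..N + 1. R j * mu_d p (s (j - 1))) + travel_cost p * mu_t p (s N) 0"
proof -
  interpret prob_space P using P by (simp add: ambiguity_set_def)
  note I = ambiguity_integrals[OF P]
  note [simp] = integrable.intros[OF I(1)] integrable.intros[OF I(2)] integrable.intros[OF I(3)]
  define U where "U \<xi> = W + (\<Sum>j=1..N. A j * travel j \<xi>) + (\<Sum>j=2..N + 1. R j * service j \<xi>)" for \<xi>
  have int_W: "has_bochner_integral P (\<lambda>_. W) W"
    by (simp add: has_bochner_integral_iff prob_space)
  have int_U: "has_bochner_integral P U (W + (\<Sum>j=1..N. A j * mu_t p (s (j - 1)) (s j)) +
      (\<Sum>j=2..N + 1. R j * mu_d p (s (j - 1))))"
    unfolding U_def
    by (intro has_bochner_integral_add has_bochner_integral_sum has_bochner_integral_mult_right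
        int_W I)
  have int_dual: "integrable P (dual_value D)" for D
    unfolding dual_value_def[abs_def]
    by (intro Bochner_Integration.integrable_add Bochner_Integration.integrable_diff
        Bochner_Integration.integrable_sum integrable_mult_right) auto
  have meas: "core \<in> borel_measurable P"
    unfolding core_def[abs_def]
    by (intro borel_measurable_Max borel_measurable_integrable[OF int_dual]) simp
  have int_core: "integrable P core"
  proof (rule Bochner_Integration.integrable_bound)
    show "integrable P (\<lambda>\<xi>. \<bar>dual_value {} \<xi>\<bar> + \<bar>U \<xi>\<bar>)"
      using int_dual int_U by (intro Bochner_Integration.integrable_add integrable_abs)
        (auto simp: has_bochner_integral_iff)
    \<comment> \<open>\<open>core\<close> lies between one of its affine pieces and the affine
      majorant, both of which are integrable.\<close>
    have "\<bar>core \<xi>\<bar> \<le> \<bar>dual_value {} \<xi>\<bar> + \<bar>U \<xi>\<bar>" if "\<xi> \<in> space P" for \<xi>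
      using dual_value_le_core[of "{}" \<xi>] le[of \<xi>] that ambiguity_space[OF P] by (simp add: U_def)
    then show "AE \<xi> in P. norm (core \<xi>) \<le> norm (\<bar>dual_value {} \<xi>\<bar> + \<bar>U \<xi>\<bar>)" by simp
  qed (rule meas)
  have "(\<integral>\<xi>. recourse p x a \<xi> \<partial>P) = (\<integral>\<xi>. core \<xi> \<partial>P) + travel_cost p * mu_t p (s N) 0"
    unfolding recourse_core using int_core I(3) by (simp add: has_bochner_integral_iff)
  moreover have "(\<integral>\<xi>. core \<xi> \<partial>P) \<le> (\<integral>\<xi>. U \<xi> \<partial>P)"
    using int_core int_U le[folded U_def] ambiguity_space[OF P]
    by (intro integral_mono) (simp_all add: has_bochner_integral_iff)
  ultimately show ?thesis using int_U by (simp add: has_bochner_integral_iff)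
qed

section \<open>Finitely supported distributions in the ambiguity set\<close>

lemma scenario_measurable:
  assumes "M = restrict_space (scenario_space p) (support_set p)"
  shows "e \<in> arcs p \<Longrightarrow> (\<lambda>\<xi>. fst \<xi> e) \<in> borel_measurable M"
    and "i \<in> {1..N} \<Longrightarrow> (\<lambda>\<xi>. snd \<xi> i) \<in> borel_measurable M"
  unfolding assms
  by (rule measurable_restrict_space1; simp add: scenario_space_def;
      intro measurable_compose[OF measurable_fst measurable_component_singleton]
        measurable_compose[OF measurable_snd measurable_component_singleton]; simp)+

text \<open>A \<open>pmf\<close> measures all sets, whereas members of the ambiguity set carry the
  trace of the product sigma-algebra. The image measure changes the sigma-algebra and keeps the
  expectations of measurable functions.\<close>

lemma pmf_in_ambiguity_set:
  assumes fin: "finite (set_pmf q)" and supp: "set_pmf q \<subseteq> support_set p"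
    and t: "\<And>i i'. (i, i') \<in> arcs p \<Longrightarrow> measure_pmf.expectation q (\<lambda>\<xi>. fst \<xi> (i, i')) = mu_t p i i'"
    and d: "\<And>i. i \<in> {1..N} \<Longrightarrow> measure_pmf.expectation q (\<lambda>\<xi>. snd \<xi> i) = mu_d p i"
  obtains P where "P \<in> ambiguity_set p"
    "(\<integral>\<xi>. recourse p x a \<xi> \<partial>P) = measure_pmf.expectation q (recourse p x a)"
proof -
  define M where "M = restrict_space (scenario_space p) (support_set p)"
  obtain \<xi>0 where \<xi>0: "\<xi>0 \<in> support_set p" using supp set_pmf_not_empty[of q] by blast
  \<comment> \<open>The map must send every scenario into the support set, including those of
    probability zero, where a fixed point is substituted.\<close>
  define h where "h \<xi> = (if \<xi> \<in> support_set p then \<xi> else \<xi>0)" for \<xi>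
  have space: "space M = support_set p"
    by (auto simp: M_def space_restrict_space support_set_def)
  have h: "h \<in> measurable (measure_pmf q) M"
    by (simp add: space h_def \<xi>0)
  define P where "P = distr (measure_pmf q) M h"
  note meas = scenario_measurable[OF M_def]
  have E: "integrable P f \<and> (\<integral>\<xi>. f \<xi> \<partial>P) = measure_pmf.expectation q f"
    if f: "f \<in> borel_measurable M" for f :: "scenario \<Rightarrow> real"
  proof
    show "integrable P f"
      unfolding P_def integrable_distr_eq[OF h f] by (rule integrable_measure_pmf_finite[OF fin])
    have "(\<integral>\<xi>. f \<xi> \<partial>P) = measure_pmf.expectation q (\<lambda>\<xi>. f (h \<xi>))"
      unfolding P_def by (rule integral_distr[OF h f])
    also have "\<dots> = measure_pmf.expectation q f"
      by (rule integral_cong_AE) (use supp in \<open>auto simp: AE_measure_pmf_iff h_def\<close>)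
    finally show "(\<integral>\<xi>. f \<xi> \<partial>P) = measure_pmf.expectation q f" .
  qed
  have "core \<in> borel_measurable M"
    unfolding core_def[abs_def] dual_value_def
    by (intro borel_measurable_Max borel_measurable_add borel_measurable_diff borel_measurable_sum
        borel_measurable_times borel_measurable_const)
      (auto simp: travel_def[abs_def] service_def[abs_def] intro!: meas arc_in[simplified] s_pred_range[simplified])
  moreover have "return_time \<in> borel_measurable M"
    unfolding return_time_def[abs_def] by (rule meas(1)[OF return_arc_in])
  ultimately have "recourse p x a \<in> borel_measurable M"
    unfolding recourse_core[abs_def] by measurable
  then have "(\<integral>\<xi>. recourse p x a \<xi> \<partial>P) = measure_pmf.expectation q (recourse p x a)"
    using E by blast
  moreover have "P \<in> ambiguity_set p"
    unfolding ambiguity_set_def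
  proof (intro CollectI conjI ballI)
    show "prob_space P" unfolding P_def by (rule measure_pmf.prob_space_distr[OF h])
    show "sets P = sets (restrict_space (scenario_space p) (support_set p))"
      by (simp add: P_def M_def)
    show "case e of (i, i') \<Rightarrow> has_bochner_integral P (\<lambda>(t, d). t (i, i')) (mu_t p i i')"
      if "e \<in> arcs p" for e
      using E[OF meas(1)[OF that]] t[of "fst e" "snd e"] that
      by (simp add: has_bochner_integral_iff case_prod_unfold)
    show "has_bochner_integral P (\<lambda>(t, d). d i) (mu_d p i)" if "i \<in> {1..N}" for i
      using E[OF meas(2)[OF that]] d[OF that] by (simp add: has_bochner_integral_iff case_prod_unfold)
  qed
  ultimately show thesis using that by blast
qed

lemma dual_value_diff:
  "dual_value D \<xi>' - dual_value D \<xi> =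
     (\<Sum>j=1..N. (dual D j + travel_cost p) * (travel j \<xi>' - travel j \<xi>)) +
     (\<Sum>j=2..N + 1. dual D j * (service j \<xi>' - service j \<xi>))"
  unfolding dual_value_def right_diff_distrib sum_subtractf by simp

text \<open>A difference of constant sign is cheapest at the same endpoint of the slope interval for
  all points. As this endpoint does not depend on the scenario, it can be taken out of an
  expectation.\<close>

lemma monotone_slope:
  fixes f g :: "'b \<Rightarrow> real" and l h :: real
  assumes "(\<forall>y\<in>S. f y \<le> g y) \<or> (\<forall>y\<in>S. g y \<le> f y)"
  shows "\<exists>k\<in>{l, h}. \<forall>c y. l \<le> c \<longrightarrow> c \<le> h \<longrightarrow> y \<in> S \<longrightarrow> k * (g y - f y) \<le> c * (g y - f y)"
  using assms
proof
  assume "\<forall>y\<in>S. f y \<le> g y"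
  then show ?thesis by (intro bexI[of _ l]) (auto intro!: mult_right_mono)
next
  assume "\<forall>y\<in>S. g y \<le> f y"
  then show ?thesis by (intro bexI[of _ h]) (auto intro!: mult_right_mono_neg)
qed

text \<open>The bounds on the multipliers are exact penalty parameters: every coordinate of \<open>q\<close> can be
  moved monotonically inside the box until its mean is right, at a price of at most the extreme
  slope of the recourse function times the change of the mean.\<close>

lemma pmf_penalty:
  assumes fin: "finite (set_pmf q)" and supp: "set_pmf q \<subseteq> support_set p"
    and V: "\<And>P. P \<in> ambiguity_set p \<Longrightarrow> (\<integral>\<xi>. recourse p x a \<xi> \<partial>P) \<le> V"
  defines "mt \<equiv> \<lambda>j. measure_pmf.expectation q (travel j) - mu_t p (s (j - 1)) (s j)"
    and "md \<equiv> \<lambda>j. measure_pmf.expectation q (service j) - mu_d p (s (j - 1))"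
  shows "measure_pmf.expectation q core \<le> V - travel_cost p * mu_t p (s N) 0 +
    (\<Sum>j=1..N. max (alpha_lo p (s (j - 1)) (s j) * mt j) (alpha_hi p (s (j - 1)) (s j) * mt j)) +
    (\<Sum>j=2..N + 1. max (P1l p * md j) (P1u p * md j))"
proof -
  note int [simp] = integrable_measure_pmf_finite[OF fin]
  have mean: "l \<le> measure_pmf.expectation q f \<and> measure_pmf.expectation q f \<le> u"
    if "\<And>\<xi>. \<xi> \<in> support_set p \<Longrightarrow> l \<le> f \<xi> \<and> f \<xi> \<le> u" for f :: "scenario \<Rightarrow> real" and l u
    using that[OF subsetD[OF supp]]
    by (auto intro!: measure_pmf.integral_ge_const measure_pmf.integral_le_const
        simp: AE_measure_pmf_iff simp del: split_paired_All)
  have "\<exists>A B. A + B * measure_pmf.expectation q (\<lambda>\<xi>. fst \<xi> e) = mu_t p (fst e) (snd e) \<and>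
      (\<forall>r. t_lo p (fst e) (snd e) \<le> r \<and> r \<le> t_hi p (fst e) (snd e) \<longrightarrow>
        t_lo p (fst e) (snd e) \<le> A + B * r \<and> A + B * r \<le> t_hi p (fst e) (snd e)) \<and>
      ((\<forall>r. t_lo p (fst e) (snd e) \<le> r \<and> r \<le> t_hi p (fst e) (snd e) \<longrightarrow> r \<le> A + B * r) \<or>
       (\<forall>r. t_lo p (fst e) (snd e) \<le> r \<and> r \<le> t_hi p (fst e) (snd e) \<longrightarrow> A + B * r \<le> r))"
    if "e \<in> arcs p" for e
  proof -
    have e: "(fst e, snd e) \<in> arcs p" using that by simp
    have "t_lo p (fst e) (snd e) \<le> measure_pmf.expectation q (\<lambda>\<xi>. fst \<xi> e) \<and>
        measure_pmf.expectation q (\<lambda>\<xi>. fst \<xi> e) \<le> t_hi p (fst e) (snd e)"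
      by (rule mean) (use that in \<open>auto simp: support_set_def\<close>)
    then show ?thesis
      using mu_bounds(1)[OF e] by (intro affine_recentring) blast+
  qed
  then obtain At Bt where t: "\<And>e. e \<in> arcs p \<Longrightarrow>
      At e + Bt e * measure_pmf.expectation q (\<lambda>\<xi>. fst \<xi> e) = mu_t p (fst e) (snd e) \<and>
      (\<forall>r. t_lo p (fst e) (snd e) \<le> r \<and> r \<le> t_hi p (fst e) (snd e) \<longrightarrow>
        t_lo p (fst e) (snd e) \<le> At e + Bt e * r \<and> At e + Bt e * r \<le> t_hi p (fst e) (snd e)) \<and>
      ((\<forall>r. t_lo p (fst e) (snd e) \<le> r \<and> r \<le> t_hi p (fst e) (snd e) \<longrightarrow> r \<le> At e + Bt e * r) \<or>
       (\<forall>r. t_lo p (fst e) (snd e) \<le> r \<and> r \<le> t_hi p (fst e) (snd e) \<longrightarrow> At e + Bt e * r \<le> r))"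
    by metis
  have "\<exists>A B. A + B * measure_pmf.expectation q (\<lambda>\<xi>. snd \<xi> i) = mu_d p i \<and>
      (\<forall>r. d_lo p i \<le> r \<and> r \<le> d_hi p i \<longrightarrow> d_lo p i \<le> A + B * r \<and> A + B * r \<le> d_hi p i) \<and>
      ((\<forall>r. d_lo p i \<le> r \<and> r \<le> d_hi p i \<longrightarrow> r \<le> A + B * r) \<or>
       (\<forall>r. d_lo p i \<le> r \<and> r \<le> d_hi p i \<longrightarrow> A + B * r \<le> r))"
    if "i \<in> {1..N}" for i
  proof -
    have "d_lo p i \<le> measure_pmf.expectation q (\<lambda>\<xi>. snd \<xi> i) \<and>
        measure_pmf.expectation q (\<lambda>\<xi>. snd \<xi> i) \<le> d_hi p i"
      by (rule mean) (use that in \<open>auto simp: support_set_def\<close>)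
    then show ?thesis
      using mu_bounds(2)[OF that] by (intro affine_recentring) blast+
  qed
  then obtain Ad Bd where d: "\<And>i. i \<in> {1..N} \<Longrightarrow>
      Ad i + Bd i * measure_pmf.expectation q (\<lambda>\<xi>. snd \<xi> i) = mu_d p i \<and>
      (\<forall>r. d_lo p i \<le> r \<and> r \<le> d_hi p i \<longrightarrow>
        d_lo p i \<le> Ad i + Bd i * r \<and> Ad i + Bd i * r \<le> d_hi p i) \<and>
      ((\<forall>r. d_lo p i \<le> r \<and> r \<le> d_hi p i \<longrightarrow> r \<le> Ad i + Bd i * r) \<or>
       (\<forall>r. d_lo p i \<le> r \<and> r \<le> d_hi p i \<longrightarrow> Ad i + Bd i * r \<le> r))"
    by metis
  \<comment> \<open>All coordinates are recentred at once, also those off the route, because the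
    image distribution must have the full mean \<open>\<mu>\<close>.\<close>
  define h :: "scenario \<Rightarrow> scenario" where "h \<xi> = (restrict (\<lambda>e. At e + Bt e * fst \<xi> e) (arcs p),
      restrict (\<lambda>i. Ad i + Bd i * snd \<xi> i) {1..N})" for \<xi>
  have h_supp: "h \<xi> \<in> support_set p" if "\<xi> \<in> support_set p" for \<xi>
    unfolding h_def
  proof (rule restrict_in_support_set)
    show "t_lo p i i' \<le> At (i, i') + Bt (i, i') * fst \<xi> (i, i') \<and>
        At (i, i') + Bt (i, i') * fst \<xi> (i, i') \<le> t_hi p i i'" if "(i, i') \<in> arcs p" for i i'
      using t[OF that] \<open>\<xi> \<in> support_set p\<close> that by (auto simp: support_set_def)
    show "d_lo p i \<le> Ad i + Bd i * snd \<xi> i \<and> Ad i + Bd i * snd \<xi> i \<le> d_hi p i"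
      if "i \<in> {1..N}" for i
      using d[OF that] \<open>\<xi> \<in> support_set p\<close> that by (auto simp: support_set_def)
  qed
  have Et: "measure_pmf.expectation q (\<lambda>\<xi>. fst (h \<xi>) (i, i')) = mu_t p i i'" if "(i, i') \<in> arcs p" for i i'
    using t[OF that] that by (simp add: h_def)
  have Ed: "measure_pmf.expectation q (\<lambda>\<xi>. snd (h \<xi>) i) = mu_d p i" if "i \<in> {1..N}" for i
    using d[OF that] that by (simp add: h_def)
  obtain P where P: "P \<in> ambiguity_set p"
    "(\<integral>\<xi>. recourse p x a \<xi> \<partial>P) = measure_pmf.expectation (map_pmf h q) (recourse p x a)"
    by (rule pmf_in_ambiguity_set[of "map_pmf h q"])
      (use fin supp h_supp Et Ed in \<open>auto simp: integral_map_pmf\<close>)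
  have Er: "measure_pmf.expectation q (\<lambda>\<xi>. return_time (h \<xi>)) = mu_t p (s N) 0"
    unfolding return_time_def by (rule Et[OF return_arc_in])
  have "measure_pmf.expectation (map_pmf h q) (recourse p x a) =
      measure_pmf.expectation q (\<lambda>\<xi>. core (h \<xi>)) + travel_cost p * mu_t p (s N) 0"
    by (simp add: integral_map_pmf recourse_core Er)
  then have core_h: "measure_pmf.expectation q (\<lambda>\<xi>. core (h \<xi>)) \<le> V - travel_cost p * mu_t p (s N) 0"
    using V[OF P(1)] P(2) by simp
  have "\<exists>k\<in>{alpha_lo p (s (j - 1)) (s j), alpha_hi p (s (j - 1)) (s j)}. \<forall>c \<xi>.
      alpha_lo p (s (j - 1)) (s j) \<le> c \<longrightarrow> c \<le> alpha_hi p (s (j - 1)) (s j) \<longrightarrow> \<xi> \<in> support_set p \<longrightarrow>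
      k * (travel j (h \<xi>) - travel j \<xi>) \<le> c * (travel j (h \<xi>) - travel j \<xi>)" if "j \<in> {1..N}" for j
    by (rule monotone_slope)
      (use t[OF arc_in[OF that]] support_travel[OF _ that] arc_in[OF that] in
        \<open>auto simp: h_def travel_def\<close>)
  then obtain kt where kt: "\<And>j. j \<in> {1..N} \<Longrightarrow>
      kt j \<in> {alpha_lo p (s (j - 1)) (s j), alpha_hi p (s (j - 1)) (s j)} \<and> (\<forall>c \<xi>.
      alpha_lo p (s (j - 1)) (s j) \<le> c \<longrightarrow> c \<le> alpha_hi p (s (j - 1)) (s j) \<longrightarrow> \<xi> \<in> support_set p \<longrightarrow>
      kt j * (travel j (h \<xi>) - travel j \<xi>) \<le> c * (travel j (h \<xi>) - travel j \<xi>))"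
    by metis
  have "\<exists>k\<in>{P1l p, P1u p}. \<forall>c \<xi>. P1l p \<le> c \<longrightarrow> c \<le> P1u p \<longrightarrow> \<xi> \<in> support_set p \<longrightarrow>
      k * (service j (h \<xi>) - service j \<xi>) \<le> c * (service j (h \<xi>) - service j \<xi>)"
    if "j \<in> {2..N + 1}" for j
    by (rule monotone_slope)
      (use d[OF s_pred_range[OF that]] support_service[OF _ that] s_pred_range[OF that] in
        \<open>auto simp: h_def service_def\<close>)
  then obtain kd where kd: "\<And>j. j \<in> {2..N + 1} \<Longrightarrow> kd j \<in> {P1l p, P1u p} \<and>
      (\<forall>c \<xi>. P1l p \<le> c \<longrightarrow> c \<le> P1u p \<longrightarrow> \<xi> \<in> support_set p \<longrightarrow>
      kd j * (service j (h \<xi>) - service j \<xi>) \<le> c * (service j (h \<xi>) - service j \<xi>))"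
    by metis
  \<comment> \<open>The affine piece active at \<open>\<xi>\<close> still bounds \<open>core\<close>
    from below at \<open>h \<xi>\<close>. Its slopes lie in the intervals, so the endpoints
    \<open>kt\<close> and \<open>kd\<close> bound its change from below.\<close>
  have pointwise: "core \<xi> \<le> core (h \<xi>) - (\<Sum>j=1..N. kt j * (travel j (h \<xi>) - travel j \<xi>)) -
      (\<Sum>j=2..N + 1. kd j * (service j (h \<xi>) - service j \<xi>))" if \<xi>: "\<xi> \<in> support_set p" for \<xi>
  proof -
    obtain D where D: "D \<in> ends" "core \<xi> = dual_value D \<xi>" by (rule core_attained)
    have "(\<Sum>j=1..N. kt j * (travel j (h \<xi>) - travel j \<xi>)) \<le>
        (\<Sum>j=1..N. (dual D j + travel_cost p) * (travel j (h \<xi>) - travel j \<xi>))"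
      by (rule sum_mono) (use kt dual_slope_travel \<xi> in blast)
    moreover have "(\<Sum>j=2..N + 1. kd j * (service j (h \<xi>) - service j \<xi>)) \<le>
        (\<Sum>j=2..N + 1. dual D j * (service j (h \<xi>) - service j \<xi>))"
      by (rule sum_mono) (use kd dual_slope[OF D(1)] \<xi> in blast)
    ultimately show ?thesis
      using dual_value_diff[of D "h \<xi>" \<xi>] dual_value_le_core[OF D(1), of "h \<xi>"] D(2) by linarith
  qed
  have "measure_pmf.expectation q core \<le> measure_pmf.expectation q (\<lambda>\<xi>. core (h \<xi>) -
      (\<Sum>j=1..N. kt j * (travel j (h \<xi>) - travel j \<xi>)) -
      (\<Sum>j=2..N + 1. kd j * (service j (h \<xi>) - service j \<xi>)))"
    by (rule integral_mono_AE) (use pointwise supp in \<open>auto simp: AE_measure_pmf_iff\<close>)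
  also have "\<dots> = measure_pmf.expectation q (\<lambda>\<xi>. core (h \<xi>)) -
      (\<Sum>j=1..N. kt j * (measure_pmf.expectation q (\<lambda>\<xi>. travel j (h \<xi>)) -
        measure_pmf.expectation q (travel j))) -
      (\<Sum>j=2..N + 1. kd j * (measure_pmf.expectation q (\<lambda>\<xi>. service j (h \<xi>)) -
        measure_pmf.expectation q (service j)))"
    by (simp add: Bochner_Integration.integral_sum del: sum.cl_ivl_Suc)
  also have "(\<Sum>j=1..N. kt j * (measure_pmf.expectation q (\<lambda>\<xi>. travel j (h \<xi>)) -
        measure_pmf.expectation q (travel j))) = (\<Sum>j=1..N. - (kt j * mt j))"
  proof (rule sum.cong)
    fix j assume "j \<in> {1..N}"
    then have "measure_pmf.expectation q (\<lambda>\<xi>. travel j (h \<xi>)) = mu_t p (s (j - 1)) (s j)"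
      unfolding travel_def by (intro Et arc_in)
    then show "kt j * (measure_pmf.expectation q (\<lambda>\<xi>. travel j (h \<xi>)) -
        measure_pmf.expectation q (travel j)) = - (kt j * mt j)"
      by (simp add: mt_def algebra_simps)
  qed simp
  also have "(\<Sum>j=2..N + 1. kd j * (measure_pmf.expectation q (\<lambda>\<xi>. service j (h \<xi>)) -
        measure_pmf.expectation q (service j))) = (\<Sum>j=2..N + 1. - (kd j * md j))"
  proof (rule sum.cong)
    fix j assume "j \<in> {2..N + 1}"
    then have "measure_pmf.expectation q (\<lambda>\<xi>. service j (h \<xi>)) = mu_d p (s (j - 1))"
      unfolding service_def by (intro Ed s_pred_range)
    then show "kd j * (measure_pmf.expectation q (\<lambda>\<xi>. service j (h \<xi>)) -
        measure_pmf.expectation q (service j)) = - (kd j * md j)"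
      by (simp add: md_def algebra_simps)
  qed simp
  finally have "measure_pmf.expectation q core \<le> V - travel_cost p * mu_t p (s N) 0 +
      (\<Sum>j=1..N. kt j * mt j) + (\<Sum>j=2..N + 1. kd j * md j)"
    using core_h by (simp add: sum_negf del: sum.cl_ivl_Suc)
  moreover have "(\<Sum>j=1..N. kt j * mt j) \<le> (\<Sum>j=1..N.
      max (alpha_lo p (s (j - 1)) (s j) * mt j) (alpha_hi p (s (j - 1)) (s j) * mt j))"
    by (rule sum_mono) (use kt in fastforce)
  moreover have "(\<Sum>j=2..N + 1. kd j * md j) \<le> (\<Sum>j=2..N + 1. max (P1l p * md j) (P1u p * md j))"
    by (rule sum_mono) (use kd in fastforce)
  ultimately show ?thesis by linarith
qed

text \<open>The multipliers come from the set of pairs of mean error and excess value over all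
  finitely supported distributions: it is convex by mixing, and \<open>pmf_penalty\<close> places it
  below the support function of the multiplier box.\<close>

lemma moment_multipliers:
  assumes V: "\<And>P. P \<in> ambiguity_set p \<Longrightarrow> (\<integral>\<xi>. recourse p x a \<xi> \<partial>P) \<le> V"
  obtains A R where
    "\<And>j. j \<in> {1..N} \<Longrightarrow> alpha_lo p (s (j - 1)) (s j) \<le> A j \<and> A j \<le> alpha_hi p (s (j - 1)) (s j)"
    "\<And>j. j \<in> {2..N + 1} \<Longrightarrow> P1l p \<le> R j \<and> R j \<le> P1u p"
    "\<And>\<xi>. \<xi> \<in> support_set p \<Longrightarrow> core \<xi> \<le> V - travel_cost p * mu_t p (s N) 0 +
       (\<Sum>j=1..N. A j * (travel j \<xi> - mu_t p (s (j - 1)) (s j))) +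
       (\<Sum>j=2..N + 1. R j * (service j \<xi> - mu_d p (s (j - 1))))"
proof -
  define V' where "V' = V - travel_cost p * mu_t p (s N) 0"
  define mom :: "scenario pmf \<Rightarrow> nat + nat \<Rightarrow> real" where
    "mom q = case_sum (\<lambda>j. measure_pmf.expectation q (travel j) - mu_t p (s (j - 1)) (s j))
       (\<lambda>j. measure_pmf.expectation q (service j) - mu_d p (s (j - 1)))" for q
  define l where "l = case_sum (\<lambda>j. alpha_lo p (s (j - 1)) (s j)) (\<lambda>j::nat. P1l p)"
  define u where "u = case_sum (\<lambda>j. alpha_hi p (s (j - 1)) (s j)) (\<lambda>j::nat. P1u p)"
  define K where "K = {(mom q, measure_pmf.expectation q core - V') | q.
    finite (set_pmf q) \<and> set_pmf q \<subseteq> support_set p}"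
  have sum_E: "(\<Sum>e\<in>{1..N} <+> {2..N + 1}. f e) = (\<Sum>j=1..N. f (Inl j)) + (\<Sum>j=2..N + 1. f (Inr j))"
    for f :: "nat + nat \<Rightarrow> real"
    by (subst sum.Plus) (simp_all add: o_def)
  have "\<exists>c. (\<forall>e\<in>{1..N} <+> {2..N + 1}. l e \<le> c e \<and> c e \<le> u e) \<and>
      (\<forall>m v. (m, v) \<in> K \<longrightarrow> v \<le> (\<Sum>e\<in>{1..N} <+> {2..N + 1}. c e * m e))"
  proof (rule box_multipliers)
    fix m v m' v' and \<theta> :: real
    assume K: "(m, v) \<in> K" "(m', v') \<in> K" and th: "0 \<le> \<theta>" "\<theta> \<le> 1"
    obtain q1 where q1: "m = mom q1" "v = measure_pmf.expectation q1 core - V'"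
      "finite (set_pmf q1)" "set_pmf q1 \<subseteq> support_set p" using K(1) by (auto simp: K_def)
    obtain q2 where q2: "m' = mom q2" "v' = measure_pmf.expectation q2 core - V'"
      "finite (set_pmf q2)" "set_pmf q2 \<subseteq> support_set p" using K(2) by (auto simp: K_def)
    obtain q where q: "finite (set_pmf q)" "set_pmf q \<subseteq> support_set p"
      "\<And>f :: scenario \<Rightarrow> real. measure_pmf.expectation q f =
         (1 - \<theta>) * measure_pmf.expectation q1 f + \<theta> * measure_pmf.expectation q2 f"
      using pmf_mixture[OF q1(3) q2(3) th q1(4) q2(4)] by blast
    have "(\<lambda>e. (1 - \<theta>) * m e + \<theta> * m' e) = mom q"
      by (rule ext) (simp add: mom_def q1(1) q2(1) q(3) algebra_simps split: sum.split)
    moreover have "(1 - \<theta>) * v + \<theta> * v' = measure_pmf.expectation q core - V'"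
      by (simp add: q1(2) q2(2) q(3) algebra_simps)
    ultimately show "((\<lambda>e. (1 - \<theta>) * m e + \<theta> * m' e), (1 - \<theta>) * v + \<theta> * v') \<in> K"
      using q(1,2) by (auto simp: K_def)
  next
    show "l e \<le> u e" for e
      using P1_le P2_le travel_cost_nonneg
      by (simp add: l_def u_def alpha_lo_def alpha_hi_def split: sum.split)
  next
    fix m v assume "(m, v) \<in> K"
    then obtain q where q: "m = mom q" "v = measure_pmf.expectation q core - V'"
      "finite (set_pmf q)" "set_pmf q \<subseteq> support_set p" by (auto simp: K_def)
    show "v \<le> (\<Sum>e\<in>{1..N} <+> {2..N + 1}. max (l e * m e) (u e * m e))"
      using pmf_penalty[OF q(3,4) V] unfolding sum_E q(1,2)
      by (simp add: l_def u_def mom_def V'_def del: sum.cl_ivl_Suc)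
  qed simp
  then obtain c where c: "\<And>e. e \<in> {1..N} <+> {2..N + 1} \<Longrightarrow> l e \<le> c e \<and> c e \<le> u e"
    "\<And>m v. (m, v) \<in> K \<Longrightarrow> v \<le> (\<Sum>e\<in>{1..N} <+> {2..N + 1}. c e * m e)" by blast
  show thesis
  proof (rule that[of "\<lambda>j. c (Inl j)" "\<lambda>j. c (Inr j)"])
    show "alpha_lo p (s (j - 1)) (s j) \<le> c (Inl j) \<and> c (Inl j) \<le> alpha_hi p (s (j - 1)) (s j)"
      if "j \<in> {1..N}" for j
      using c(1)[OF InlI[OF that]] by (simp add: l_def u_def)
    show "P1l p \<le> c (Inr j) \<and> c (Inr j) \<le> P1u p" if "j \<in> {2..N + 1}" for j
      using c(1)[OF InrI[OF that]] by (simp add: l_def u_def)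
    fix \<xi> assume "\<xi> \<in> support_set p"
    \<comment> \<open>A point mass turns the bound on expectations into the bound at a single
      scenario.\<close>
    then have "(mom (return_pmf \<xi>), measure_pmf.expectation (return_pmf \<xi>) core - V') \<in> K"
      unfolding K_def by (intro CollectI exI[of _ "return_pmf \<xi>"]) simp
    from c(2)[OF this] show "core \<xi> \<le> V - travel_cost p * mu_t p (s N) 0 +
       (\<Sum>j=1..N. c (Inl j) * (travel j \<xi> - mu_t p (s (j - 1)) (s j))) +
       (\<Sum>j=2..N + 1. c (Inr j) * (service j \<xi> - mu_d p (s (j - 1))))"
      unfolding sum_E by (simp add: mom_def V'_def del: sum.cl_ivl_Suc)
  qed
qed

lemma worst_case_finite:
  obtains V where "worst_case p x a = ereal V"
    "\<And>P. P \<in> ambiguity_set p \<Longrightarrow> (\<integral>\<xi>. recourse p x a \<xi> \<partial>P) \<le> V"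
proof -
  \<comment> \<open>With zero multipliers the node sums bound \<open>core\<close> by a constant on
    the box, so the supremum is not infinite from above; any one member of the ambiguity set bounds
    it from below.\<close>
  define W where "W = Max ((\<lambda>D. \<Sum>j=1..N + 2. node (\<lambda>_. 0) (\<lambda>_. 0) j (next_end (N + 2) D j)) ` ends)"
  have "core \<xi> \<le> W + (\<Sum>j=1..N. 0 * travel j \<xi>) + (\<Sum>j=2..N + 1. 0 * service j \<xi>)"
    if \<xi>: "\<xi> \<in> support_set p" for \<xi>
  proof -
    obtain D where D: "D \<in> ends" "core \<xi> = dual_value D \<xi>" by (rule core_attained)
    have "(\<Sum>j=1..N + 2. node (\<lambda>_. 0) (\<lambda>_. 0) j (next_end (N + 2) D j)) \<le> W"
      unfolding W_def by (rule Max_ge) (use D in auto)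
    then show ?thesis
      using dual_value_le_node[OF \<xi>, of D "\<lambda>_. 0" "\<lambda>_. 0"] D(2) by linarith
  qed
  note le = recourse_expectation_le[OF _ this]
  obtain U where U: "\<And>P. P \<in> ambiguity_set p \<Longrightarrow> (\<integral>\<xi>. recourse p x a \<xi> \<partial>P) \<le> U"
    using le by blast
  obtain P where P: "P \<in> ambiguity_set p" using ambiguity_nonempty by blast
  have "worst_case p x a \<le> ereal U"
    unfolding worst_case_def using U by (intro SUP_least) simp
  moreover have "ereal (\<integral>\<xi>. recourse p x a \<xi> \<partial>P) \<le> worst_case p x a" if "P \<in> ambiguity_set p" for P
    unfolding worst_case_def using that by (rule SUP_upper)
  moreover from this[OF P] calculation(1) obtain V where V: "worst_case p x a = ereal V"
    by (cases "worst_case p x a") auto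
  ultimately show thesis by (intro that[OF V]) (simp add: V)
qed

text \<open>The last part states attainment: some completion reaches \<open>V\<close> and does not
  merely approach it. The correspondence of optimal solutions rests on this.\<close>

lemma decision_value:
  assumes x: "x \<in> assignments p"
  shows "\<exists>V. worst_case p x a = ereal V \<and> (\<forall>z. (x, a, z) \<in> milp_feasible p \<longrightarrow> V \<le> milp_objective p x z) \<and>
    (\<exists>z. (x, a, z) \<in> milp_feasible p \<and> milp_objective p x z \<le> V)"
proof -
  obtain V where wc: "worst_case p x a = ereal V"
    and V: "\<And>P. P \<in> ambiguity_set p \<Longrightarrow> (\<integral>\<xi>. recourse p x a \<xi> \<partial>P) \<le> V"
    by (rule worst_case_finite) blast
  have "V \<le> milp_objective p x z" if z: "(x, a, z) \<in> milp_feasible p" for z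
  proof -
    define A where "A = (\<lambda>j. alpha z (s (j - 1)) (s j))"
    define R where "R = (\<lambda>j. rho z (s (j - 1)))"
    note lower = milp_lower[OF z, folded A_def R_def]
    have "core \<xi> \<le> (\<Sum>j=1..N + 2. beta z j) + (\<Sum>j=1..N. A j * travel j \<xi>) +
        (\<Sum>j=2..N + 1. R j * service j \<xi>)" if \<xi>: "\<xi> \<in> support_set p" for \<xi>
    proof -
      obtain D where D: "D \<in> ends" "core \<xi> = dual_value D \<xi>" by (rule core_attained)
      have "(\<Sum>j=1..N + 2. node A R j (next_end (N + 2) D j)) \<le> (\<Sum>j=1..N + 2. beta z j)"
        by (rule block_sums_le[OF lower(2)]) auto
      then show ?thesis
        using dual_value_le_node[OF \<xi>, of D A R] D(2) by linarith
    qed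
    from recourse_expectation_le[OF _ this] have "worst_case p x a \<le> ereal (milp_objective p x z)"
      unfolding worst_case_def lower(1) pos_objective_def
      by (intro SUP_least) (simp add: algebra_simps del: sum.cl_ivl_Suc)
    then show ?thesis using wc by simp
  qed
  moreover have "\<exists>z. (x, a, z) \<in> milp_feasible p \<and> milp_objective p x z \<le> V"
  proof -
    obtain A R where A: "\<And>j. j \<in> {1..N} \<Longrightarrow>
        alpha_lo p (s (j - 1)) (s j) \<le> A j \<and> A j \<le> alpha_hi p (s (j - 1)) (s j)"
      and R: "\<And>j. j \<in> {2..N + 1} \<Longrightarrow> P1l p \<le> R j \<and> R j \<le> P1u p"
      and le: "\<And>\<xi>. \<xi> \<in> support_set p \<Longrightarrow> core \<xi> \<le> V - travel_cost p * mu_t p (s N) 0 +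
         (\<Sum>j=1..N. A j * (travel j \<xi> - mu_t p (s (j - 1)) (s j))) +
         (\<Sum>j=2..N + 1. R j * (service j \<xi> - mu_d p (s (j - 1))))"
      using moment_multipliers[OF V] by blast
    \<comment> \<open>\<open>W\<close> is the share of \<open>V\<close> left for
      \<open>beta\<close>: a completion with multipliers \<open>A\<close> and \<open>R\<close> has
      objective at most \<open>V\<close> exactly if its \<open>beta\<close> sum to at most
      \<open>W\<close>.\<close>
    define W where "W = V - travel_cost p * mu_t p (s N) 0 -
        (\<Sum>j=1..N. A j * mu_t p (s (j - 1)) (s j)) - (\<Sum>j=2..N + 1. R j * mu_d p (s (j - 1)))"
    have "(\<Sum>j=1..N + 2. node A R j (next_end (N + 2) D j)) \<le> W" if D: "D \<subseteq> {1..N + 2}" for D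
    proof -
      obtain \<xi> where \<xi>: "\<xi> \<in> support_set p"
        "(\<Sum>j=1..N + 2. node A R j (next_end (N + 2) (D - {N + 2}) j)) = dual_value (D - {N + 2}) \<xi> -
          (\<Sum>j=1..N. A j * travel j \<xi>) - (\<Sum>j=2..N + 1. R j * service j \<xi>)"
        by (rule node_attained)
      have "D - {N + 2} \<in> ends" using D by force
      then have "dual_value (D - {N + 2}) \<xi> \<le> core \<xi>" by (rule dual_value_le_core)
      then show ?thesis
        using le[OF \<xi>(1)] \<xi>(2) unfolding next_end_Diff right_diff_distrib sum_subtractf W_def by linarith
    qed
    then show ?thesis
    proof (rule block_potentials)
      fix b assume b: "\<And>k v. 1 \<le> k \<Longrightarrow> k \<le> v \<Longrightarrow> v \<le> N + 2 \<Longrightarrow>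
        (\<Sum>j=k..v. node A R j v) \<le> (\<Sum>j=k..v. b j)" "(\<Sum>j=1..N + 2. b j) \<le> W"
      obtain z where "(x, a, z) \<in> milp_feasible p" "milp_objective p x z = pos_objective A R b"
        using milp_upper[OF A R b(1) x] by blast
      then show ?thesis
        using b(2) by (intro exI[of _ z]) (simp add: pos_objective_def W_def del: sum.cl_ivl_Suc)
    qed
  qed
  ultimately show ?thesis using wc by blast
qed

end

subsection \<open>Optimal values and solutions\<close>

text \<open>Column sums make the customer of each position a function; row sums make this function
  injective.\<close>

lemma assignment_permutation:
  assumes y: "y \<in> assignments p"
  obtains s where "bij_betw s {1..customers p} {1..customers p}" "s 0 = 0"
    "y = (\<lambda>i j. if j \<in> {1..customers p} \<and> i = s j then 1 else 0)"
proof -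
  let ?N = "customers p"
  have out: "y i j = 0" if "i \<notin> {1..?N} \<or> j \<notin> {1..?N}" for i j
    using y that by (auto simp: assignments_def)
  have bin: "y i j = 0 \<or> y i j = 1" for i j
    using y out[of i j] unfolding assignments_def by blast
  have unique: "\<exists>i\<in>A. h i = 1 \<and> (\<forall>i'\<in>A. i' \<noteq> i \<longrightarrow> h i' = 0)"
    if A: "finite A" and h: "\<And>i. h i = 0 \<or> h i = (1::real)" and sum: "sum h A = 1" for h and A :: "nat set"
  proof -
    obtain i where i: "i \<in> A" "h i \<noteq> 0" using sum by (metis sum.neutral zero_neq_one)
    then have hi: "h i = 1" using h by blast
    then have "sum h (A - {i}) = 0" using A sum i(1) by (simp add: sum_diff1)
    moreover have "0 \<le> h i'" for i' using h[of i'] by auto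
    ultimately have "\<forall>i'\<in>A - {i}. h i' = 0" using A by (simp add: sum_nonneg_eq_0_iff)
    then show ?thesis using i hi by auto
  qed
  have "\<exists>i\<in>{1..?N}. y i j = 1 \<and> (\<forall>i'\<in>{1..?N}. i' \<noteq> i \<longrightarrow> y i' j = 0)" if "j \<in> {1..?N}" for j
    by (rule unique) (use y that bin in \<open>auto simp: assignments_def\<close>)
  then obtain r where r: "\<And>j. j \<in> {1..?N} \<Longrightarrow> r j \<in> {1..?N} \<and> y (r j) j = 1 \<and>
      (\<forall>i'\<in>{1..?N}. i' \<noteq> r j \<longrightarrow> y i' j = 0)" by metis
  have row: "\<exists>j\<in>{1..?N}. y i j = 1 \<and> (\<forall>j'\<in>{1..?N}. j' \<noteq> j \<longrightarrow> y i j' = 0)" if "i \<in> {1..?N}" for i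
    by (rule unique) (use y that bin in \<open>auto simp: assignments_def\<close>)
  have "inj_on r {1..?N}"
  proof (rule inj_onI)
    fix j k assume jk: "j \<in> {1..?N}" "k \<in> {1..?N}" "r j = r k"
    then have "y (r j) j = 1" "y (r j) k = 1" "r j \<in> {1..?N}"
      using r[OF jk(1)] r[OF jk(2)] by simp_all
    then show "j = k" using row[of "r j"] jk by (metis zero_neq_one)
  qed
  then have "bij_betw r {1..?N} {1..?N}"
    using r by (intro bij_betw_imageI endo_inj_surj) auto
  \<comment> \<open>The choice leaves \<open>r 0\<close> arbitrary; the depot is put there.\<close>
  define s where "s = r(0 := 0)"
  have "bij_betw s {1..?N} {1..?N} = bij_betw r {1..?N} {1..?N}"
    by (rule bij_betw_cong) (auto simp: s_def)
  moreover have "y i j = (if j \<in> {1..?N} \<and> i = s j then 1 else 0)" for i j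
  proof (cases "i \<in> {1..?N} \<and> j \<in> {1..?N}")
    case True
    then have "i \<noteq> r j \<Longrightarrow> y i j = 0" "y (r j) j = 1" using r[of j] by blast+
    then show ?thesis using True by (auto simp: s_def)
  next
    case False
    then show ?thesis using out[of i j] r[of j] by (auto simp: s_def)
  qed
  ultimately show thesis
    using that[of s] \<open>bij_betw r {1..?N} {1..?N}\<close> by (auto simp: s_def fun_eq_iff)
qed

lemma (in dhras_data) worst_case_eq_milp:
  assumes "y \<in> assignments p" "a \<in> schedules p"
  shows "\<exists>V. worst_case p y a = ereal V \<and> (\<forall>z. (y, a, z) \<in> milp_feasible p \<longrightarrow> V \<le> milp_objective p y z) \<and>
    (\<exists>z. (y, a, z) \<in> milp_feasible p \<and> milp_objective p y z \<le> V)"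
proof -
  obtain s where s: "bij_betw s {1..N} {1..N}" "s 0 = 0"
    "y = (\<lambda>i j. if j \<in> {1..N} \<and> i = s j then 1 else 0)"
    by (rule assignment_permutation[OF assms(1)])
  interpret dhras_decision p s a
    by unfold_locales (use s assms in auto)
  have "y = x" by (simp add: s(3) x_def fun_eq_iff)
  then show ?thesis using decision_value assms(1) by simp
qed

theorem mainTheorem1:
  fixes p :: dhras
  assumes "customers p \<ge> 1" and "horizon p > 0"
    and "\<forall>j\<in>{1..customers p}. wait_cost p j \<ge> 0 \<and> idle_cost p j \<ge> 0"
    and "over_cost p \<ge> 0" and "travel_cost p \<ge> 0"
    and "\<forall>i\<in>{1..customers p}. d_lo p i \<ge> 0"
    and "\<forall>(i, i')\<in>arcs p. t_lo p i i' \<ge> 0"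
    and "ambiguity_set p \<noteq> {}"
    and "\<forall>j\<in>{1..<customers p}. idle_cost p (j + 1) \<le> idle_cost p j + wait_cost p j"
  shows "dhras_value p = milp_value p \<and>
    (\<forall>x\<in>assignments p. \<forall>a\<in>schedules p.
       dhras_optimal p x a \<longleftrightarrow> (\<exists>z. milp_optimal p x a z))"
proof -
  interpret dhras_data p
    by unfold_locales (use assms in auto)
  have feas: "y \<in> assignments p \<and> a \<in> schedules p" if "(y, a, z) \<in> milp_feasible p" for y a z
    using that by (simp add: milp_feasible_def)
  \<comment> \<open>From here on the argument is formal: \<open>V\<close> is the worst case of a
    decision and also the attained minimum of the program over its completions.\<close>
  obtain V where V: "\<And>y a. y \<in> assignments p \<Longrightarrow> a \<in> schedules p \<Longrightarrow> worst_case p y a = ereal (V y a) \<and>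
      (\<forall>z. (y, a, z) \<in> milp_feasible p \<longrightarrow> V y a \<le> milp_objective p y z) \<and>
      (\<exists>z. (y, a, z) \<in> milp_feasible p \<and> milp_objective p y z \<le> V y a)"
    using worst_case_eq_milp by metis
  have "dhras_value p = milp_value p"
  proof (rule antisym)
    show "dhras_value p \<le> milp_value p"
      unfolding dhras_value_def milp_value_def
    proof (rule INF_mono)
      fix y assume "y \<in> milp_feasible p"
      then obtain x a z where y: "y = (x, a, z)" "(x, a, z) \<in> milp_feasible p" by (cases y) auto
      then show "\<exists>m\<in>assignments p \<times> schedules p. (case m of (x, a) \<Rightarrow> worst_case p x a) \<le>
          (case y of (x, a, z) \<Rightarrow> ereal (milp_objective p x z))"
        using feas[OF y(2)] V[of x a] by (intro bexI[of _ "(x, a)"]) auto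
    qed
    show "milp_value p \<le> dhras_value p"
      unfolding dhras_value_def milp_value_def
    proof (rule INF_mono)
      fix m assume "m \<in> assignments p \<times> schedules p"
      then obtain x a where m: "m = (x, a)" "x \<in> assignments p" "a \<in> schedules p" by auto
      obtain z where "(x, a, z) \<in> milp_feasible p" "milp_objective p x z \<le> V x a"
        using V[OF m(2,3)] by blast
      then show "\<exists>y\<in>milp_feasible p. (case y of (x, a, z) \<Rightarrow> ereal (milp_objective p x z)) \<le>
          (case m of (x, a) \<Rightarrow> worst_case p x a)"
        using V[OF m(2,3)] m(1) by (intro bexI[of _ "(x, a, z)"]) auto
    qed
  qed
  moreover have "dhras_optimal p x a \<longleftrightarrow> (\<exists>z. milp_optimal p x a z)"
    if xa: "x \<in> assignments p" "a \<in> schedules p" for x a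
  proof -
    have dhras: "dhras_optimal p x a \<longleftrightarrow> (\<forall>y\<in>assignments p. \<forall>b\<in>schedules p. V x a \<le> V y b)"
    proof -
      have wc: "worst_case p y b = ereal (V y b)" if "y \<in> assignments p" "b \<in> schedules p" for y b
        using V[OF that] by blast
      have "dhras_optimal p x a \<longleftrightarrow>
          (\<forall>y\<in>assignments p. \<forall>b\<in>schedules p. worst_case p x a \<le> worst_case p y b)"
        using xa by (auto simp: dhras_optimal_def is_arg_min_def not_less)
      then show ?thesis by (simp add: wc xa)
    qed
    have milp: "milp_optimal p x a z \<longleftrightarrow> (x, a, z) \<in> milp_feasible p \<and>
        (\<forall>y b z'. (y, b, z') \<in> milp_feasible p \<longrightarrow> milp_objective p x z \<le> milp_objective p y z')" for z
      by (auto simp: milp_optimal_def is_arg_min_def not_less)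
    show ?thesis
    proof
      assume opt: "dhras_optimal p x a"
      obtain z where z: "(x, a, z) \<in> milp_feasible p" "milp_objective p x z \<le> V x a"
        using V[OF xa] by blast
      have "milp_objective p x z \<le> milp_objective p y z'" if "(y, b, z') \<in> milp_feasible p" for y b z'
        using z(2) opt[unfolded dhras] feas[OF that] V[of y b] that by (meson order_trans)
      then show "\<exists>z. milp_optimal p x a z" using z(1) milp by blast
    next
      assume "\<exists>z. milp_optimal p x a z"
      then obtain z where z: "(x, a, z) \<in> milp_feasible p"
        "\<And>y b z'. (y, b, z') \<in> milp_feasible p \<Longrightarrow> milp_objective p x z \<le> milp_objective p y z'"
        using milp by blast
      have "V x a \<le> V y b" if "y \<in> assignments p" "b \<in> schedules p" for y b
        using V[OF that] z V[OF xa] by (meson order_trans)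
      then show "dhras_optimal p x a" unfolding dhras by blast
    qed
  qed
  ultimately show ?thesis by blast
qed

end
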